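(* For all integers $n,k\ge 1$, $$N_{n+k}(x)=\frac{1}{k!}\sum_{w\in\mathfrak{S}_k}B_w(x)\,N_{n,\ell_w}(x).$$
   Context: $\mathfrak{S}_n$ is the symmetric group on $\{1,\ldots,n\}$; permutations are written in one-line notation $w=w_1\cdots w_n$, and $\operatorname{des}(w)=|\{i:w_i>w_{i+1}\}|$. The Narayana polynomial is $N_n(x)=\sum_{k=0}^{n-1}\frac1n\binom nk\binom n{k+1}x^k$. The type B Narayana polynomial is $B_n(x)=\sum_{k=0}^{n-1}\binom{n-1}{k}^2x^k$. For a permutation $w$ with cycle type $(\lambda_1,\ldots,\lambda_\ell)$ (fixed points counted as cycles), $\ell_w=\ell$ is the number of cycles of $w$ and $B_w(x)=B_{\lambda_1}(x)\cdots B_{\lambda_\ell}(x)$. The stack-sorting map $s:\mathfrak{S}_m\to\mathfrak{S}_m$ is defined as follows. Process the entries of $w$ from left to right with an initially empty stack. At each step, if the stack is empty or the next entry of $w$ is smaller than the top entry of the stack, push the next entry onto the stack; otherwise, pop the top entry of the stack to the end of the output. When all entries of $w$ have been pushed, pop the remaining stack entries one by one to the end of the output. The output is $s(w)$. Let $\mathfrak{S}_{n,k}=\{w\in\mathfrak{S}_{n+k}: w_i=i\text{ for all }i>k\}$ and $N_{n,k}(x)=\sum_{w\in s^{-1}(\mathfrak{S}_{n,k})}x^{\operatorname{des}(w)}$. *)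

theory Defs
  imports
    "HOL-Combinatorics.Orbits"
    "HOL-Library.Multiset"
    "HOL-Computational_Algebra.Polynomial"
begin

text \<open>
  A permutation of \<open>{1..m}\<close> is a function \<open>w\<close> with \<open>w permutes {1..m}\<close>, so that \<open>w i\<close> is the
  entry \<open>w\<^sub>i\<close> of the one-line notation; \<open>w\<close> is the identity outside \<open>{1..m}\<close>.
\<close>

definition sym_perms :: "nat \<Rightarrow> (nat \<Rightarrow> nat) set" where
  "sym_perms m = {w. w permutes {1..m}}"

definition one_line :: "nat \<Rightarrow> (nat \<Rightarrow> nat) \<Rightarrow> nat list" where
  "one_line m w = map w [1..<Suc m]"

definition perm_of_word :: "nat list \<Rightarrow> nat \<Rightarrow> nat" where
  "perm_of_word xs i = (if i \<in> {1..length xs} then xs ! (i - 1) else i)"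

definition des :: "nat \<Rightarrow> (nat \<Rightarrow> nat) \<Rightarrow> nat" where
  "des m w = card {i \<in> {1..<m}. w i > w (i + 1)}"

definition narayana_poly :: "nat \<Rightarrow> rat poly" where
  "narayana_poly n =
     (\<Sum>k<n. monom (1 / of_nat n * of_nat (n choose k) * of_nat (n choose (k + 1))) k)"

definition narayana_B_poly :: "nat \<Rightarrow> rat poly" where
  "narayana_B_poly n = (\<Sum>k<n. monom (of_nat ((n - 1) choose k) ^ 2) k)"

text \<open>
  The cycles of \<open>w\<close> are represented by their supports, i.e. the orbits of \<open>w\<close> on \<open>{1..m}\<close>;
  a fixed point \<open>i\<close> contributes the orbit \<open>{i}\<close>.
\<close>

definition cycle_supports :: "nat \<Rightarrow> (nat \<Rightarrow> nat) \<Rightarrow> nat set set" where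
  "cycle_supports m w = orbit w ` {1..m}"

definition cycle_type :: "nat \<Rightarrow> (nat \<Rightarrow> nat) \<Rightarrow> nat multiset" where
  "cycle_type m w = image_mset card (mset_set (cycle_supports m w))"

definition num_cycles :: "nat \<Rightarrow> (nat \<Rightarrow> nat) \<Rightarrow> nat" where
  "num_cycles m w = size (cycle_type m w)"

definition B_perm :: "nat \<Rightarrow> (nat \<Rightarrow> nat) \<Rightarrow> rat poly" where
  "B_perm m w = (\<Prod>p\<in>#cycle_type m w. narayana_B_poly p)"

text \<open>
  The first argument is the unread input, the second the stack with its top at the head; the
  result is the output still to be produced.
\<close>

fun stack_sort_run :: "nat list \<Rightarrow> nat list \<Rightarrow> nat list" where
  "stack_sort_run [] st = st"
| "stack_sort_run (x # xs) [] = stack_sort_run xs [x]"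
| "stack_sort_run (x # xs) (t # st) =
     (if x < t then stack_sort_run xs (x # t # st)
      else t # stack_sort_run (x # xs) st)"

definition stack_sort :: "nat \<Rightarrow> (nat \<Rightarrow> nat) \<Rightarrow> (nat \<Rightarrow> nat)" where
  "stack_sort m w = perm_of_word (stack_sort_run (one_line m w) [])"

definition fixing_perms :: "nat \<Rightarrow> nat \<Rightarrow> (nat \<Rightarrow> nat) set" where
  "fixing_perms n k = {w \<in> sym_perms (n + k). \<forall>i\<in>{1..n + k}. i > k \<longrightarrow> w i = i}"

definition narayana2_poly :: "nat \<Rightarrow> nat \<Rightarrow> rat poly" where
  "narayana2_poly n k =
     (\<Sum>w \<in> {w \<in> sym_perms (n + k). stack_sort (n + k) w \<in> fixing_perms n k}.
        monom 1 (des (n + k) w))"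

lemma mset_stack_sort_run: "mset (stack_sort_run xs st) = mset xs + mset st"
  by (induction xs st rule: stack_sort_run.induct) auto

lemma perm_of_word_permutes:
  assumes "mset xs = mset [1..<Suc m]"
  shows "perm_of_word xs permutes {1..m}"
proof -
  have len: "length xs = m" using mset_eq_length[OF assms] by simp
  have d: "distinct xs" using mset_eq_imp_distinct_iff[OF assms] by simp
  have s: "set xs = {1..m}" using mset_eq_setD[OF assms] by auto
  have inj: "inj_on (perm_of_word xs) {1..m}"
    using d len by (auto simp: inj_on_def perm_of_word_def nth_eq_iff_index_eq)
  have "perm_of_word xs ` {1..m} \<subseteq> {1..m}"
    using s len by (force simp: perm_of_word_def dest: nth_mem)
  with inj have "bij_betw (perm_of_word xs) {1..m} {1..m}"
    by (simp add: bij_betw_def endo_inj_surj)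
  then show ?thesis
    by (rule bij_imp_permutes) (auto simp: perm_of_word_def len)
qed

lemma stack_sort_in_sym_perms:
  assumes "w \<in> sym_perms m"
  shows "stack_sort m w \<in> sym_perms m"
proof -
  have w: "w permutes {1..m}" using assms by (simp add: sym_perms_def)
  have "mset (one_line m w) = image_mset w (mset_set {1..m})"
    by (simp add: one_line_def atLeastLessThanSuc_atLeastAtMost del: upt_Suc)
  also have "\<dots> = mset_set {1..m}"
    using w by (simp add: image_mset_mset_set permutes_inj_on permutes_image)
  also have "\<dots> = mset [1..<Suc m]"
    by (simp add: atLeastLessThanSuc_atLeastAtMost del: upt_Suc)
  finally have "mset (stack_sort_run (one_line m w) []) = mset [1..<Suc m]"
    by (simp only: mset_stack_sort_run mset.simps add_0_right)
  then show ?thesis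
    unfolding stack_sort_def sym_perms_def mem_Collect_eq by (rule perm_of_word_permutes)
qed

lemma one_line_stack_sort:
  "one_line m (stack_sort m w) = stack_sort_run (one_line m w) []"
proof -
  have "length (stack_sort_run (one_line m w) []) = m"
    using arg_cong[OF mset_stack_sort_run[of "one_line m w" "[]"], of size]
    by (simp add: one_line_def del: upt_Suc)
  moreover have "one_line m (perm_of_word xs) = xs" if "length xs = m" for xs
    unfolding one_line_def using that
    by (intro nth_equalityI) (auto simp: perm_of_word_def simp del: upt_Suc)
  ultimately show ?thesis
    unfolding stack_sort_def by blast
qed

end

theory Submission
  imports Defs "HOL-Library.Sublist" "HOL-Combinatorics.Multiset_Permutations"
    "HOL-Computational_Algebra.Formal_Power_Series"
begin

text \<open>
  Fix a rational \<open>x\<close>. Splitting a word at its maximum as \<open>w = L m R\<close> gives \<open>s(w) = s(L) s(R) m\<close>, and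
  hence a recursion for the generating functions \<open>F\<^sub>n(z) = \<Sum>\<^sub>k N\<^sub>n\<^sub>,\<^sub>k(x) z\<^sup>k / k!\<close>: if the
  \<open>n\<close> largest remaining letters end \<open>s(L) s(R)\<close> in increasing order, then either \<open>s(R)\<close> already
  ends with all of them, or \<open>s(R)\<close> consists of the last few of them and \<open>s(L)\<close> ends with the others.

  For \<open>k = 0\<close> the recursion says that the series \<open>N = \<Sum>\<^sub>m\<^sub>\<ge>\<^sub>1 N\<^sub>m\<^sub>,\<^sub>0(x) y\<^sup>m\<close> solves
  \<open>N = y (1 + N) (1 + x N)\<close>, which identifies its coefficients as Narayana polynomials and those of
  \<open>S = y N' / N\<close> as type B Narayana polynomials. By the exponential formula the right-hand side of the
  theorem is the coefficient of \<open>y\<^sup>k\<close> in \<open>F\<^sub>n(L(y))\<close>, where \<open>L = \<Sum>\<^sub>j B\<^sub>j(x) y\<^sup>j / j\<close> and so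
  \<open>L' = S\<close>. Both \<open>F\<^sub>0(L(y))\<close> and \<open>1 + N\<close> solve the Riccati equation \<open>P' = P (x P + 1 - x) S\<close>, so
  they agree; the recursion then yields \<open>F\<^sub>n(L(y)) = \<Sum>\<^sub>k N\<^sub>n\<^sub>+\<^sub>k(x) y\<^sup>k\<close> for all \<open>n \<ge> 1\<close>.
\<close>

unbundle fps_syntax

lemma sum_Pow_card:
  fixes g :: "nat \<Rightarrow> 'a::comm_semiring_1"
  assumes "finite A"
  shows "(\<Sum>D\<in>Pow A. g (card D)) = (\<Sum>j\<le>card A. of_nat (card A choose j) * g j)"
proof -
  have "(\<Sum>D\<in>Pow A. g (card D)) = (\<Sum>j\<le>card A. \<Sum>D\<in>{D \<in> Pow A. card D = j}. g (card D))"
    using assms by (intro sum.group[symmetric]) (auto intro: card_mono)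
  also have "\<dots> = (\<Sum>j\<le>card A. of_nat (card A choose j) * g j)"
    using n_subsets[OF assms] by (intro sum.cong refl) (simp add: Pow_def)
  finally show ?thesis .
qed

section \<open>Words with a prescribed sorted suffix after stack sorting\<close>

fun word_des :: "nat list \<Rightarrow> nat" where
  "word_des [] = 0"
| "word_des [a] = 0"
| "word_des (a # b # xs) = (if a > b then 1 else 0) + word_des (b # xs)"

text \<open>The step into \<open>m\<close> is never a descent, and the step out of it always
  is.\<close>

lemma word_des_append_max:
  assumes "\<And>a. a \<in> set L \<union> set R \<Longrightarrow> a < m"
  shows "word_des (L @ m # R) = word_des L + (if R = [] then 0 else Suc (word_des R))"
  using assms by (induction L rule: word_des.induct) (cases R; force)+

lemma word_des_conv_card: "word_des xs = card {i. Suc i < length xs \<and> xs ! i > xs ! Suc i}"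
proof (induction xs rule: word_des.induct)
  case (3 a b xs)
  let ?P = "\<lambda>ys i. Suc i < length ys \<and> ys ! i > ys ! Suc i"
  have "{i. ?P (a # b # xs) i} = (if a > b then {0} else {}) \<union> Suc ` {i. ?P (b # xs) i}"
  proof (rule set_eqI)
    show "i \<in> {i. ?P (a # b # xs) i} \<longleftrightarrow>
      i \<in> (if a > b then {0} else {}) \<union> Suc ` {i. ?P (b # xs) i}" for i
      by (cases i) auto
  qed
  moreover have "finite {i. ?P (b # xs) i}"
    by (rule finite_subset[of _ "{..<length (b # xs)}"]) auto
  ultimately show ?case
    using 3 by (simp add: card_Un_disjoint card_image)
qed simp_all

section \<open>Stack sorting of words and the decomposition at the maximum\<close>

abbreviation stack_sort_word :: "nat list \<Rightarrow> nat list" where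
  "stack_sort_word xs \<equiv> stack_sort_run xs []"

text \<open>Every letter on the stack is smaller than \<open>m\<close>, so the stack is emptied
  before \<open>m\<close> is pushed.\<close>

lemma stack_sort_run_append_max:
  assumes "\<And>a. a \<in> set xs \<union> set st \<Longrightarrow> a < m"
  shows "stack_sort_run (xs @ m # ys) st = stack_sort_run xs st @ stack_sort_run ys [m]"
  using assms
proof (induction xs st rule: stack_sort_run.induct)
  case (1 st)
  then show ?case
    by (induction st) force+
qed auto

text \<open>No letter of \<open>xs\<close> is large enough to pop \<open>m\<close>, so
  \<open>m\<close> leaves the stack last.\<close>

lemma stack_sort_run_max_bottom:
  assumes "\<And>a. a \<in> set xs \<union> set st \<Longrightarrow> a < m"
  shows "stack_sort_run xs (st @ [m]) = stack_sort_run xs st @ [m]"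
  using assms by (induction xs st rule: stack_sort_run.induct) auto

lemma stack_sort_word_append_max:
  assumes "\<And>a. a \<in> set L \<union> set R \<Longrightarrow> a < m"
  shows "stack_sort_word (L @ m # R) = stack_sort_word L @ stack_sort_word R @ [m]"
  using assms stack_sort_run_append_max[of L "[]" m R] stack_sort_run_max_bottom[of R "[]" m]
  by simp

lemma set_stack_sort_word [simp]: "set (stack_sort_word xs) = set xs"
  using arg_cong[OF mset_stack_sort_run[of xs "[]"], of set_mset] by simp

lemma distinct_stack_sort_word [simp]: "distinct (stack_sort_word xs) \<longleftrightarrow> distinct xs"
  using mset_eq_imp_distinct_iff[OF mset_stack_sort_run[of xs "[]", simplified]] .

text \<open>
  Both the decomposition at the maximum and the recursion stay within words over \<open>C \<union> set ts\<close> with all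
  letters of \<open>C\<close> below those of \<open>ts\<close>, so no standardization of subwords is needed.
\<close>

definition suffix_words :: "nat set \<Rightarrow> nat list \<Rightarrow> nat list set" where
  "suffix_words C ts = {xs. distinct xs \<and> set xs = C \<union> set ts \<and> suffix ts (stack_sort_word xs)}"

definition small_below :: "nat set \<Rightarrow> nat list \<Rightarrow> bool" where
  "small_below C ts \<longleftrightarrow> finite C \<and> sorted_wrt (<) ts \<and> (\<forall>c\<in>C. \<forall>t\<in>set ts. c < t)"

lemma finite_suffix_words [simp]: "finite C \<Longrightarrow> finite (suffix_words C ts)"
  by (rule finite_subset[OF _ finite_permutations_of_set[of "C \<union> set ts"]])
    (auto simp: suffix_words_def permutations_of_set_def)

lemma small_below_distinct: "small_below C ts \<Longrightarrow> distinct ts"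
  by (simp add: small_below_def strict_sorted_iff)

lemma small_below_disjoint: "small_below C ts \<Longrightarrow> C \<inter> set ts = {}"
  by (auto simp: small_below_def)

lemma set_take_drop_Un: "set ts = set (take i ts) \<union> set (drop i ts)"
  by (metis append_take_drop_id set_append)

text \<open>Removing the final \<open>m\<close> leaves the condition that \<open>ts\<close> is a
  suffix of \<open>s(L) s(R)\<close>. In the first family it lies within \<open>s(R)\<close>, and
  \<open>D\<close> is the set of small letters of \<open>R\<close>. In the second it starts inside
  \<open>s(L)\<close>, so \<open>s(R)\<close> is a tail of \<open>ts\<close> and all of
  \<open>C\<close> lies in \<open>L\<close>. The bound \<open>1 \<le> i\<close> keeps the families
  apart.\<close>

lemma suffix_words_snoc:
  assumes "small_below C (ts @ [m])"
  shows "suffix_words C (ts @ [m]) = (\<lambda>(L, R). L @ m # R) `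
    ((\<Union>D\<in>Pow C. suffix_words (C - D) [] \<times> suffix_words D ts) \<union>
     (\<Union>i\<in>{1..length ts}. suffix_words C (take i ts) \<times> suffix_words {} (drop i ts)))"
    (is "?W = ?f ` (?U \<union> ?V)")
proof
  have disj: "C \<inter> set ts = {}" and d: "distinct ts"
    using small_below_disjoint[OF assms] small_below_distinct[OF assms] by auto
  have less: "c < m" if "c \<in> C \<union> set ts" for c
    using assms that by (auto simp: small_below_def sorted_wrt_append)
  show "?W \<subseteq> ?f ` (?U \<union> ?V)"
  proof
    fix xs assume xs: "xs \<in> ?W"
    then have dxs: "distinct xs" and sxs: "set xs = insert m (C \<union> set ts)"
      and suf: "suffix (ts @ [m]) (stack_sort_word xs)"
      by (auto simp: suffix_words_def)
    from sxs obtain L R where LR: "xs = L @ m # R"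
      by (metis insertI1 split_list)
    have "m \<notin> C \<union> set ts" using less by blast
    moreover have "m \<notin> set L \<union> set R" "insert m (set L \<union> set R) = insert m (C \<union> set ts)"
      using dxs sxs unfolding LR by auto
    ultimately have sLR: "set L \<union> set R = C \<union> set ts" "set L \<inter> set R = {}"
      using dxs unfolding LR by (metis insert_ident, auto)
    have "suffix (ts @ [m]) ((stack_sort_word L @ stack_sort_word R) @ [m])"
      using suf stack_sort_word_append_max[of L R m] less sLR unfolding LR by simp
    then have "suffix ts (stack_sort_word L @ stack_sort_word R)"
      unfolding suffix_snoc by auto
    \<comment> \<open>An empty \<open>us\<close> would mean \<open>ts = stack_sort_word R\<close>;
      that case is absorbed into the first alternative.\<close>
    then have "suffix ts (stack_sort_word R) \<or>
        (\<exists>us. us \<noteq> [] \<and> ts = us @ stack_sort_word R \<and> suffix us (stack_sort_word L))"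
      unfolding suffix_append by (metis append_Nil suffix_order.refl)
    then have "(L, R) \<in> ?U \<union> ?V"
    proof (elim disjE exE conjE)
      assume s: "suffix ts (stack_sort_word R)"
      then have "set ts \<subseteq> set R" by (metis set_mono_suffix set_stack_sort_word)
      then have "L \<in> suffix_words (C - (set R - set ts)) []" "R \<in> suffix_words (set R - set ts) ts"
        "set R - set ts \<in> Pow C"
        using dxs disj sLR s unfolding LR suffix_words_def by auto
      then show ?thesis by blast
    next
      fix us assume us: "us \<noteq> []" "ts = us @ stack_sort_word R" "suffix us (stack_sort_word L)"
      define i where "i = length us"
      have *: "take i ts = us" "drop i ts = stack_sort_word R" "i \<in> {1..length ts}"
        using us(1) us(2) unfolding i_def by (auto simp: Suc_le_eq)
      have "set ts = set us \<union> set R" "set us \<inter> set R = {}"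
        using us(2) d by (metis set_append set_stack_sort_word, metis distinct_append set_stack_sort_word)
      moreover have "set us \<subseteq> set L" using us(3) by (metis set_mono_suffix set_stack_sort_word)
      ultimately have "L \<in> suffix_words C (take i ts)" "R \<in> suffix_words {} (drop i ts)"
        using dxs disj sLR us unfolding LR suffix_words_def * by auto
      with *(3) show ?thesis by blast
    qed
    then show "xs \<in> ?f ` (?U \<union> ?V)" unfolding LR by force
  qed
  show "?f ` (?U \<union> ?V) \<subseteq> ?W"
  proof safe
    fix D L R assume "D \<subseteq> C" "L \<in> suffix_words (C - D) []" "R \<in> suffix_words D ts"
    moreover from this have "set L \<union> set R = C \<union> set ts" by (auto simp: suffix_words_def)
    ultimately show "L @ m # R \<in> ?W"
      using less disj stack_sort_word_append_max[of L R m]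
      by (auto simp: suffix_words_def suffix_appendI)
  next
    fix i L R assume i: "i \<in> {1..length ts}"
      and LR: "L \<in> suffix_words C (take i ts)" "R \<in> suffix_words {} (drop i ts)"
    have s: "set ts = set (take i ts) \<union> set (drop i ts)" by (rule set_take_drop_Un)
    \<comment> \<open>\<open>R\<close> has no letters besides those of \<open>drop i ts\<close>, so
      the suffix is the whole output.\<close>
    have "stack_sort_word R = drop i ts"
    proof -
      have "length (stack_sort_word R) = length (drop i ts)"
        using LR(2) d by (simp add: suffix_words_def) (metis distinct_card distinct_drop
            distinct_stack_sort_word length_drop set_stack_sort_word)
      with LR(2) show ?thesis
        by (auto simp: suffix_words_def suffix_def)
    qed
    moreover obtain us where "stack_sort_word L = us @ take i ts"
      using LR(1) by (auto simp: suffix_words_def suffix_def)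
    ultimately have "suffix ts (stack_sort_word L @ stack_sort_word R)"
      by (metis append.assoc append_take_drop_id suffixI)
    moreover have sLR: "set L \<union> set R = C \<union> set ts" using LR s by (auto simp: suffix_words_def)
    moreover have "set (take i ts) \<inter> set (drop i ts) = {}"
      using d by (metis append_take_drop_id distinct_append)
    ultimately show "L @ m # R \<in> ?W"
      using less disj LR stack_sort_word_append_max[of L R m] s
      by (auto simp: suffix_words_def suffix_append)
  qed
qed

section \<open>The descent generating function and its recursion\<close>

definition suffix_sum :: "'a::comm_semiring_1 \<Rightarrow> nat set \<Rightarrow> nat list \<Rightarrow> 'a" where
  "suffix_sum x C ts = (\<Sum>xs\<in>suffix_words C ts. x ^ word_des xs)"

text \<open>The last factor records the descent after \<open>m\<close>, which is absent exactly when
  \<open>R\<close> is empty.\<close>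

lemma suffix_sum_prod_max:
  assumes "finite C" "finite D"
    and "\<And>a. a \<in> C \<union> set ts \<union> D \<union> set us \<Longrightarrow> a < m"
  shows "(\<Sum>(L, R)\<in>suffix_words C ts \<times> suffix_words D us. x ^ word_des (L @ m # R)) =
    suffix_sum x C ts * suffix_sum x D us * (if D = {} \<and> us = [] then 1 else x)"
proof -
  define c where "c = (if D = {} \<and> us = [] then 1 else x)"
  have "x ^ word_des (L @ m # R) = x ^ word_des L * x ^ word_des R * c"
    if "L \<in> suffix_words C ts" "R \<in> suffix_words D us" for L R
    using that assms(3) word_des_append_max[of L R m]
    by (auto simp: suffix_words_def power_add algebra_simps c_def)
  then have "(\<Sum>(L, R)\<in>suffix_words C ts \<times> suffix_words D us. x ^ word_des (L @ m # R)) =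
    (\<Sum>(L, R)\<in>suffix_words C ts \<times> suffix_words D us. x ^ word_des L * x ^ word_des R * c)"
    by (intro sum.cong) auto
  also have "\<dots> = (\<Sum>(L, R)\<in>suffix_words C ts \<times> suffix_words D us. x ^ word_des L * x ^ word_des R) * c"
    by (simp add: sum_distrib_right case_prod_unfold)
  also have "\<dots> = suffix_sum x C ts * suffix_sum x D us * c"
    by (simp add: suffix_sum_def sum_product sum.cartesian_product)
  finally show ?thesis unfolding c_def .
qed

text \<open>Sums over the two families of \<open>suffix_words_snoc\<close>: \<open>m\<close> occurs
  only once in a word, so the pair \<open>(L, R)\<close> is unique, and the letters of
  \<open>R\<close> determine which piece of the union contains it.\<close>

lemma suffix_sum_snoc:
  assumes "small_below C (ts @ [m])"
  shows "suffix_sum x C (ts @ [m]) =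
    (\<Sum>D\<in>Pow C. suffix_sum x (C - D) [] * suffix_sum x D ts * (if D = {} \<and> ts = [] then 1 else x)) +
    (\<Sum>i\<in>{1..length ts}. suffix_sum x C (take i ts) * suffix_sum x {} (drop i ts) *
      (if i = length ts then 1 else x))"
proof -
  let ?U = "\<lambda>D. suffix_words (C - D) [] \<times> suffix_words D ts"
  let ?V = "\<lambda>i. suffix_words C (take i ts) \<times> suffix_words {} (drop i ts)"
  let ?g = "\<lambda>(L, R). x ^ word_des (L @ m # R)"
  have fin: "finite C" using assms by (simp add: small_below_def)
  have disj: "C \<inter> set ts = {}" and d: "distinct ts"
    using small_below_disjoint[OF assms] small_below_distinct[OF assms] by auto
  have less: "c < m" if "c \<in> C \<union> set ts" for c
    using assms that by (auto simp: small_below_def sorted_wrt_append)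
  have finD: "finite D" if "D \<in> Pow C" for D using that fin by (auto intro: finite_subset)
  have U: "set R = D \<union> set ts" if "(L, R) \<in> ?U D" for L R D
    using that by (auto simp: suffix_words_def)
  have V: "set R = set (drop i ts)" if "(L, R) \<in> ?V i" for L R i
    using that by (auto simp: suffix_words_def)
  have card_drop: "card (set (drop i ts)) = length ts - i" for i
    using d by (simp add: distinct_card)
  have inj: "inj_on (\<lambda>(L, R). L @ m # R) ((\<Union>D\<in>Pow C. ?U D) \<union> (\<Union>i\<in>{1..length ts}. ?V i))"
  proof -
    have m: "m \<notin> set L \<and> m \<notin> set R"
      if "(L, R) \<in> (\<Union>D\<in>Pow C. ?U D) \<union> (\<Union>i\<in>{1..length ts}. ?V i)" for L R
    proof -
      have "set L \<union> set R \<subseteq> C \<union> set ts"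
        using that by (auto simp: suffix_words_def dest: in_set_takeD in_set_dropD)
      then show ?thesis using less by blast
    qed
    show ?thesis
    proof (rule inj_onI)
      fix p q assume p: "p \<in> (\<Union>D\<in>Pow C. ?U D) \<union> (\<Union>i\<in>{1..length ts}. ?V i)"
        and e: "(case p of (L, R) \<Rightarrow> L @ m # R) = (case q of (L, R) \<Rightarrow> L @ m # R)"
      obtain L R L' R' where pq: "p = (L, R)" "q = (L', R')" by (meson surj_pair)
      have "m \<notin> set L" "m \<notin> set R" using m[of L R] p unfolding pq by simp_all
      from append_Cons_eq_iff[OF this] show "p = q" using e by (simp add: pq)
    qed
  qed
  \<comment> \<open>In the first family \<open>R\<close> contains all of \<open>ts\<close>; in the
    second it misses the first \<open>i \<ge> 1\<close> letters.\<close>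
  have UV: "(\<Union>D\<in>Pow C. ?U D) \<inter> (\<Union>i\<in>{1..length ts}. ?V i) = {}"
  proof -
    have False if "p \<in> ?U D" "p \<in> ?V i" "i \<in> {1..length ts}" for p D i
    proof -
      obtain L R where p: "p = (L, R)" by fastforce
      have "set ts \<subseteq> set (drop i ts)" using that U V unfolding p by blast
      then have "length ts \<le> length ts - i"
        using card_mono[of "set (drop i ts)" "set ts"] card_drop[of i] d by (simp add: distinct_card)
      with that(3) show False unfolding atLeastAtMost_iff by linarith
    qed
    then show ?thesis by blast
  qed
  have UU: "?U D \<inter> ?U D' = {}" if "D \<in> Pow C" "D' \<in> Pow C" "D \<noteq> D'" for D D'
  proof -
    have D: "B = set (snd p) - set ts" if "B \<in> Pow C" "p \<in> ?U B" for p B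
    proof -
      have "set (snd p) = B \<union> set ts" using U[of "fst p" "snd p" B] that(2) by simp
      then show ?thesis using that(1) disj by auto
    qed
    show ?thesis
    proof (rule ccontr)
      assume "?U D \<inter> ?U D' \<noteq> {}"
      then obtain p where "p \<in> ?U D" "p \<in> ?U D'" by (metis Int_iff ex_in_conv)
      from D[OF that(1) this(1)] D[OF that(2) this(2)] that(3) show False by simp
    qed
  qed
  \<comment> \<open>The number of letters of \<open>R\<close> is \<open>length ts - i\<close>, which
    determines \<open>i\<close>.\<close>
  have VV: "?V i \<inter> ?V j = {}" if "i \<in> {1..length ts}" "j \<in> {1..length ts}" "i \<noteq> j" for i j
    using that V card_drop by (metis (no_types, lifting) atLeastAtMost_iff diff_diff_cancel
        disjoint_iff surj_pair)
  have "suffix_sum x C (ts @ [m]) = sum ?g ((\<Union>D\<in>Pow C. ?U D) \<union> (\<Union>i\<in>{1..length ts}. ?V i))"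
    unfolding suffix_sum_def suffix_words_snoc[OF assms] sum.reindex[OF inj]
    by (simp add: o_def case_prod_unfold)
  also have "\<dots> = sum ?g (\<Union>D\<in>Pow C. ?U D) + sum ?g (\<Union>i\<in>{1..length ts}. ?V i)"
    using fin finD by (intro sum.union_disjoint UV) auto
  also have "sum ?g (\<Union>D\<in>Pow C. ?U D) = (\<Sum>D\<in>Pow C. sum ?g (?U D))"
    using fin finD UU by (intro sum.UNION_disjoint) auto
  also have "sum ?g (\<Union>i\<in>{1..length ts}. ?V i) = (\<Sum>i\<in>{1..length ts}. sum ?g (?V i))"
    using fin VV by (intro sum.UNION_disjoint) auto
  also have "(\<Sum>D\<in>Pow C. sum ?g (?U D)) = (\<Sum>D\<in>Pow C. suffix_sum x (C - D) [] *
      suffix_sum x D ts * (if D = {} \<and> ts = [] then 1 else x))"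
    using fin finD less by (intro sum.cong refl suffix_sum_prod_max) auto
  also have "(\<Sum>i\<in>{1..length ts}. sum ?g (?V i)) = (\<Sum>i\<in>{1..length ts}.
      suffix_sum x C (take i ts) * suffix_sum x {} (drop i ts) * (if i = length ts then 1 else x))"
  proof (intro sum.cong refl)
    fix i assume "i \<in> {1..length ts}"
    then have "drop i ts = [] \<longleftrightarrow> i = length ts" by auto
    then show "sum ?g (?V i) = suffix_sum x C (take i ts) * suffix_sum x {} (drop i ts) *
        (if i = length ts then 1 else x)"
      using suffix_sum_prod_max[of C "{}" "take i ts" "drop i ts" m x] fin less
        set_take_drop_Un[of ts i] by auto
  qed
  finally show ?thesis .
qed

text \<open>The stack-sorted output always ends in its maximum, so requiring this suffix is no
  restriction. It lets the recursion for nonempty suffixes also handle the empty one.\<close>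

lemma suffix_sum_Max:
  assumes "finite C" "C \<noteq> {}"
  shows "suffix_sum x C [] = suffix_sum x (C - {Max C}) [Max C]"
proof -
  let ?m = "Max C"
  have "suffix [?m] (stack_sort_word xs)" if "distinct xs" "set xs = C" for xs
  proof -
    obtain L R where LR: "xs = L @ ?m # R"
      using \<open>set xs = C\<close> assms by (metis Max_in split_list)
    have "a < ?m" if "a \<in> set L \<union> set R" for a
    proof -
      have "a \<in> C" "a \<noteq> ?m" using that \<open>set xs = C\<close> \<open>distinct xs\<close> LR by auto
      then show ?thesis using assms(1) by (simp add: order.strict_iff_order)
    qed
    then show ?thesis
      using stack_sort_word_append_max[of L R ?m] LR by (auto simp: suffix_def)
  qed
  moreover have "C - {?m} \<union> set [?m] = C \<union> set []"
    using Max_in[OF assms] by auto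
  ultimately have "suffix_words C [] = suffix_words (C - {?m}) [?m]"
    unfolding suffix_words_def by auto
  then show ?thesis by (simp add: suffix_sum_def)
qed

lemma suffix_sum_empty [simp]: "suffix_sum x {} [] = 1"
proof -
  have "suffix_words {} [] = {[]}" by (auto simp: suffix_words_def)
  then show ?thesis by (simp add: suffix_sum_def)
qed

lemma small_below_Max:
  assumes "finite C" "C \<noteq> {}"
  shows "small_below (C - {Max C}) [Max C]"
  using assms by (auto simp: small_below_def order.strict_iff_order)

lemma small_below_subset: "small_below C (ts @ us) \<Longrightarrow> D \<subseteq> C \<Longrightarrow> small_below D ts"
  "small_below C (ts @ us) \<Longrightarrow> D \<subseteq> C \<Longrightarrow> small_below D us"
  by (auto simp: small_below_def sorted_wrt_append intro: finite_subset)

lemma small_below_parts: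
  assumes "small_below C (ts @ [m])" "D \<subseteq> C"
  shows "small_below (C - D) []" "small_below D ts" "small_below C (take i ts)"
    "small_below {} (drop i ts)"
proof -
  have 1: "small_below C (take i ts @ drop i ts @ [m])"
    using assms(1) by (metis append.assoc append_take_drop_id)
  have 2: "small_below C (drop i ts @ [m])" using small_below_subset(2)[OF 1] by simp
  show "small_below (C - D) []" "small_below D ts" "small_below C (take i ts)"
    "small_below {} (drop i ts)"
    using assms small_below_subset(1)[OF 1, of C] small_below_subset(1)[OF 2, of "{}"]
      small_below_subset(1)[OF assms] by (auto simp: small_below_def)
qed

text \<open>The recursion removes one letter and refers to \<open>C\<close> and \<open>ts\<close>
  only through subset sizes and lengths, so induction on the total number of letters
  applies.\<close>

lemma suffix_sum_cong_card:
  assumes "small_below C ts" "small_below C' ts'" "card C = card C'" "length ts = length ts'"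
  shows "suffix_sum x C ts = suffix_sum x C' ts'"
  using assms
proof (induction "card C + length ts" arbitrary: C C' ts ts' rule: less_induct)
  case less
  \<comment> \<open>Stated for arbitrary data because it is used twice: on the last letter of
    \<open>ts\<close> and, for empty \<open>ts\<close>, on the maximum of \<open>C\<close>.\<close>
  have snoc: "suffix_sum x A (us @ [m]) = suffix_sum x A' (us' @ [m'])"
    if A: "small_below A (us @ [m])" "small_below A' (us' @ [m'])" and c: "card A = card A'"
      and l: "length us = length us'" and n: "card A + Suc (length us) = card C + length ts"
    for A A' us us' m m'
  proof -
    have fin: "finite A" "finite A'" using A by (auto simp: small_below_def)
    \<comment> \<open>Subsets are matched along any bijection, order-preserving or not, since by
      induction only their sizes matter.\<close>
    obtain h where h: "bij_betw h A A'" using c fin finite_same_card_bij by blast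
    have 1: "suffix_sum x (A - D) [] = suffix_sum x (A' - h ` D) []"
      "suffix_sum x D us = suffix_sum x (h ` D) us'" "h ` D = {} \<longleftrightarrow> D = {}" if "D \<in> Pow A" for D
    proof -
      have D: "finite D" "h ` D \<subseteq> A'" "card (h ` D) = card D"
        using that fin h by (auto simp: bij_betw_def finite_subset inj_on_subset intro: card_image)
      then show "suffix_sum x (A - D) [] = suffix_sum x (A' - h ` D) []"
        using that n c fin A
        by (intro less(1)) (auto simp: small_below_def card_Diff_subset)
      show "suffix_sum x D us = suffix_sum x (h ` D) us'"
        using D that n l fin card_mono[of A D]
          small_below_parts(2)[OF A(1), of D] small_below_parts(2)[OF A(2), of "h ` D"]
        by (intro less(1)) auto
    qed simp
    have 2: "suffix_sum x A (take i us) = suffix_sum x A' (take i us')"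
      "suffix_sum x {} (drop i us) = suffix_sum x {} (drop i us')" for i
      using n c l small_below_parts(3,4)[OF A(1), of "{}" i] small_below_parts(3,4)[OF A(2), of "{}" i]
      by (intro less(1); auto)+
    have "(\<Sum>D\<in>Pow A. suffix_sum x (A - D) [] * suffix_sum x D us * (if D = {} \<and> us = [] then 1 else x)) =
      (\<Sum>D\<in>Pow A. suffix_sum x (A' - h ` D) [] * suffix_sum x (h ` D) us' *
        (if h ` D = {} \<and> us' = [] then 1 else x))"
      using 1 l by (intro sum.cong refl) auto
    also have "\<dots> = (\<Sum>D\<in>Pow A'. suffix_sum x (A' - D) [] * suffix_sum x D us' *
        (if D = {} \<and> us' = [] then 1 else x))"
      by (rule sum.reindex_bij_betw[OF bij_betw_Pow[OF h]])
    finally show ?thesis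
      unfolding suffix_sum_snoc[OF A(1)] suffix_sum_snoc[OF A(2)] using 2 l by simp
  qed
  have fin: "finite C" "finite C'" using less.prems by (auto simp: small_below_def)
  show ?case
  proof (cases "ts = []")
    case False
    moreover from this have ne: "ts' \<noteq> []" using less.prems(4) by auto
    ultimately have e: "ts = butlast ts @ [last ts]" "ts' = butlast ts' @ [last ts']"
      by simp_all
    show ?thesis
      using snoc[of C "butlast ts" "last ts" C' "butlast ts'" "last ts'"] e less.prems False ne
      by (simp add: Suc_diff_Suc)
  next
    case True
    then have e: "ts = []" "ts' = []" using less.prems by auto
    show ?thesis
    proof (cases "C = {}")
      case True
      then show ?thesis using e less.prems fin by simp
    next
      case False
      then have "C' \<noteq> {}" using less.prems fin by auto
      then show ?thesis
        using False e fin less.prems(3) snoc[of "C - {Max C}" "[]" "Max C" "C' - {Max C'}" "[]" "Max C'"]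
          small_below_Max[of C] small_below_Max[of C']
        by (simp add: suffix_sum_Max card_gt_0_iff card_Diff_singleton)
    qed
  qed
qed

section \<open>Translation from words to permutations\<close>

lemma des_conv_word_des: "des m w = word_des (one_line m w)"
proof -
  \<comment> \<open>Positions in \<open>des\<close> start at 1, list indices at 0.\<close>
  have 1: "bij_betw Suc {i. Suc i < m \<and> w (Suc i) > w (Suc (Suc i))} {i \<in> {1..<m}. w i > w (i + 1)}"
    by (rule bij_betwI[where g = "\<lambda>i. i - 1"]) auto
  have 2: "{i. Suc i < m \<and> w (Suc i) > w (Suc (Suc i))} =
     {i. Suc i < length (one_line m w) \<and> one_line m w ! i > one_line m w ! Suc i}"
    by (auto simp: one_line_def simp del: upt_Suc)
  show ?thesis
    unfolding des_def word_des_conv_card 2[symmetric] by (rule bij_betw_same_card[OF 1, symmetric])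
qed

lemma one_line_perm_of_word:
  "length xs = m \<Longrightarrow> one_line m (perm_of_word xs) = xs"
  unfolding one_line_def
  by (intro nth_equalityI) (auto simp: perm_of_word_def simp del: upt_Suc)

lemma perm_of_word_one_line:
  "w \<in> sym_perms m \<Longrightarrow> perm_of_word (one_line m w) = w"
  by (auto simp: fun_eq_iff perm_of_word_def one_line_def sym_perms_def permutes_def simp del: upt_Suc)

lemma mset_one_line:
  assumes "w \<in> sym_perms m"
  shows "mset (one_line m w) = mset [1..<Suc m]"
proof -
  have w: "w permutes {1..m}" using assms by (simp add: sym_perms_def)
  have "mset (one_line m w) = image_mset w (mset_set {1..m})"
    by (simp add: one_line_def atLeastLessThanSuc_atLeastAtMost del: upt_Suc)
  also have "\<dots> = mset [1..<Suc m]"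
    using w by (simp add: image_mset_mset_set permutes_inj_on permutes_image
        atLeastLessThanSuc_atLeastAtMost del: upt_Suc)
  finally show ?thesis .
qed

lemma suffix_one_line_iff:
  assumes "w \<in> sym_perms (n + k)"
  shows "suffix [Suc k..<Suc (n + k)] (one_line (n + k) w) \<longleftrightarrow> w \<in> fixing_perms n k"
proof -
  have e: "one_line (n + k) w = map w [1..<Suc k] @ map w [Suc k..<Suc (n + k)]"
    unfolding one_line_def map_append[symmetric]
    using upt_add_eq_append[of 1 "Suc k" n] by (simp add: add.commute del: upt_Suc)
  have "suffix [Suc k..<Suc (n + k)] (one_line (n + k) w) \<longleftrightarrow>
      [Suc k..<Suc (n + k)] = map w [Suc k..<Suc (n + k)]"
    unfolding e by (auto simp: suffix_def simp del: upt_Suc)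
  also have "\<dots> \<longleftrightarrow> (\<forall>i\<in>{1..n + k}. i > k \<longrightarrow> w i = i)"
    by (subst map_idI[symmetric, of _ id], simp, subst map_eq_conv) (auto simp del: upt_Suc)
  finally show ?thesis using assms by (simp add: fixing_perms_def)
qed

text \<open>One-line notation is a bijection onto the words over \<open>{1..n + k}\<close>, and
  fixing all points above \<open>k\<close> means that the sorted word ends in
  \<open>[Suc k..<Suc (n + k)]\<close>.\<close>

lemma narayana2_conv_suffix_sum:
  "poly (narayana2_poly n k) x = suffix_sum x {1..k} [Suc k..<Suc (n + k)]"
proof -
  let ?m = "n + k" and ?W = "suffix_words {1..k} [Suc k..<Suc (n + k)]"
  have set: "{1..k} \<union> set [Suc k..<Suc (n + k)] = {1..n + k}" by auto
  have "bij_betw (one_line ?m) {w \<in> sym_perms ?m. stack_sort ?m w \<in> fixing_perms n k} ?W"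
  proof (rule bij_betwI[where g = perm_of_word])
    show "one_line ?m \<in> {w \<in> sym_perms ?m. stack_sort ?m w \<in> fixing_perms n k} \<rightarrow> ?W"
    proof safe
      fix w assume w: "w \<in> sym_perms ?m" "stack_sort ?m w \<in> fixing_perms n k"
      have "distinct (one_line ?m w)" "set (one_line ?m w) = {1..n + k}"
        using mset_eq_imp_distinct_iff[OF mset_one_line[OF w(1)]]
          mset_eq_setD[OF mset_one_line[OF w(1)]]
        unfolding set_upt atLeastLessThanSuc_atLeastAtMost by (simp_all only: distinct_upt)
      with w show "one_line ?m w \<in> ?W"
        using suffix_one_line_iff[OF stack_sort_in_sym_perms[OF w(1)]]
        unfolding suffix_words_def set one_line_stack_sort by (simp del: upt_Suc)
    qed
    show "perm_of_word \<in> ?W \<rightarrow> {w \<in> sym_perms ?m. stack_sort ?m w \<in> fixing_perms n k}"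
    proof
      fix xs assume xs: "xs \<in> ?W"
      then have d: "distinct xs" "set xs = {1..?m}"
        using set by (auto simp: suffix_words_def simp del: upt_Suc)
      have "set xs = set [1..<Suc ?m]"
        unfolding d(2) set_upt atLeastLessThanSuc_atLeastAtMost ..
      then have "mset xs = mset [1..<Suc ?m]"
        using set_eq_iff_mset_eq_distinct[OF d(1) distinct_upt] by blast
      then have p: "perm_of_word xs \<in> sym_perms ?m"
        using perm_of_word_permutes by (simp add: sym_perms_def)
      have "one_line ?m (perm_of_word xs) = xs"
        using d distinct_card[of xs] by (intro one_line_perm_of_word) simp
      then have "stack_sort ?m (perm_of_word xs) \<in> fixing_perms n k"
        using xs suffix_one_line_iff[OF stack_sort_in_sym_perms[OF p]]
        by (simp add: suffix_words_def one_line_stack_sort del: upt_Suc)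
      with p show "perm_of_word xs \<in> {w \<in> sym_perms ?m. stack_sort ?m w \<in> fixing_perms n k}"
        by simp
    qed
    show "perm_of_word (one_line ?m w) = w"
      if "w \<in> {w \<in> sym_perms ?m. stack_sort ?m w \<in> fixing_perms n k}" for w
      using that by (simp add: perm_of_word_one_line)
    show "one_line ?m (perm_of_word xs) = xs" if "xs \<in> ?W" for xs
    proof -
      have "distinct xs" "set xs = {1..?m}"
        using that set by (auto simp: suffix_words_def simp del: upt_Suc)
      then show ?thesis
        using distinct_card[of xs] by (intro one_line_perm_of_word) simp
    qed
  qed
  from sum.reindex_bij_betw[OF this, of "\<lambda>xs. x ^ word_des xs"] show ?thesis
    by (simp add: narayana2_poly_def suffix_sum_def poly_sum poly_monom des_conv_word_des)
qed

text \<open>Serves to rewrite each subproblem of the recursion, over its own alphabet, as a value of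
  \<open>narayana2_poly\<close>.\<close>

lemma suffix_sum_conv_narayana2:
  assumes "small_below C ts"
  shows "suffix_sum x C ts = poly (narayana2_poly (length ts) (card C)) x"
  unfolding narayana2_conv_suffix_sum
  by (rule suffix_sum_cong_card[OF assms]) (auto simp: small_below_def simp del: upt_Suc)

lemma narayana2_poly_0_0: "poly (narayana2_poly 0 0) x = 1"
  by (simp add: narayana2_conv_suffix_sum)

text \<open>The maximum always comes out last, so one fixed point is obtained for free.\<close>

lemma narayana2_poly_0_Suc: "poly (narayana2_poly 0 (Suc k)) x = poly (narayana2_poly 1 k) x"
proof -
  have "poly (narayana2_poly 0 (Suc k)) x = suffix_sum x ({1..Suc k} - {Max {1..Suc k}}) [Max {1..Suc k}]"
    by (simp add: narayana2_conv_suffix_sum suffix_sum_Max)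
  also have "\<dots> = poly (narayana2_poly 1 k) x"
    using suffix_sum_conv_narayana2[OF small_below_Max[of "{1..Suc k}"]]
    by (simp add: card_Diff_singleton)
  finally show ?thesis .
qed

text \<open>This is \<open>suffix_sum_snoc\<close> with alphabets replaced by their sizes: either
  \<open>j\<close> small letters stand to the right of the maximum, or the first \<open>i\<close> of
  the \<open>n\<close> prescribed letters end the sorted left part.\<close>

lemma narayana2_poly_Suc:
  "poly (narayana2_poly (Suc n) k) x =
    (\<Sum>j\<le>k. of_nat (k choose j) * (poly (narayana2_poly 0 (k - j)) x *
      poly (narayana2_poly n j) x * (if j = 0 \<and> n = 0 then 1 else x))) +
    (\<Sum>i\<in>{1..n}. poly (narayana2_poly i k) x * poly (narayana2_poly (n - i) 0) x *
      (if i = n then 1 else x))"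
proof -
  let ?C = "{1..k}" and ?ts = "[Suc k..<Suc (n + k)]" and ?m = "Suc (n + k)"
  have e: "[Suc k..<Suc (Suc n + k)] = ?ts @ [?m]" by simp
  have below: "small_below ?C (?ts @ [?m])"
    unfolding e[symmetric] by (auto simp: small_below_def simp del: upt_Suc)
  note parts = small_below_parts[OF below]
  have len: "length ?ts = n" by simp
  have "(\<Sum>D\<in>Pow ?C. suffix_sum x (?C - D) [] * suffix_sum x D ?ts * (if D = {} \<and> ?ts = [] then 1 else x))
    = (\<Sum>D\<in>Pow ?C. poly (narayana2_poly 0 (k - card D)) x * poly (narayana2_poly n (card D)) x *
        (if card D = 0 \<and> n = 0 then 1 else x))"
  proof (intro sum.cong refl)
    fix D assume D: "D \<in> Pow ?C"
    then have "finite D" by (auto intro: finite_subset)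
    then show "suffix_sum x (?C - D) [] * suffix_sum x D ?ts * (if D = {} \<and> ?ts = [] then 1 else x) =
      poly (narayana2_poly 0 (k - card D)) x * poly (narayana2_poly n (card D)) x *
        (if card D = 0 \<and> n = 0 then 1 else x)"
      using D parts(1,2)[of D] by (simp add: suffix_sum_conv_narayana2 card_Diff_subset del: upt_Suc)
  qed
  also have "\<dots> = (\<Sum>j\<le>k. of_nat (k choose j) * (poly (narayana2_poly 0 (k - j)) x *
      poly (narayana2_poly n j) x * (if j = 0 \<and> n = 0 then 1 else x)))"
    using sum_Pow_card[of ?C] by simp
  finally have 1: "(\<Sum>D\<in>Pow ?C. suffix_sum x (?C - D) [] * suffix_sum x D ?ts *
      (if D = {} \<and> ?ts = [] then 1 else x)) = \<dots>" .
  have 2: "(\<Sum>i\<in>{1..length ?ts}. suffix_sum x ?C (take i ?ts) * suffix_sum x {} (drop i ?ts) *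
      (if i = length ?ts then 1 else x)) = (\<Sum>i\<in>{1..n}. poly (narayana2_poly i k) x *
        poly (narayana2_poly (n - i) 0) x * (if i = n then 1 else x))"
    unfolding len
    using parts(3,4)[of "{}"]
    by (intro sum.cong refl) (simp add: suffix_sum_conv_narayana2 min_absorb2 del: upt_Suc take_upt drop_upt)
  show ?thesis
    unfolding narayana2_conv_suffix_sum e suffix_sum_snoc[OF below] 1[unfolded narayana2_conv_suffix_sum] 2[unfolded narayana2_conv_suffix_sum] ..
qed

section \<open>The Narayana series\<close>

text \<open>The coefficient of \<open>u ^ (m - k)\<close> in \<open>((1 + u) * (1 + x * u)) ^ m\<close>.\<close>

definition shifted_binomial_sum :: "'a::comm_semiring_1 \<Rightarrow> nat \<Rightarrow> nat \<Rightarrow> 'a" where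
  "shifted_binomial_sum x m k = (\<Sum>i\<le>m. of_nat ((m choose i) * (m choose (k + i))) * x ^ i)"

lemma shifted_binomial_sum_0: "shifted_binomial_sum x 0 k = (if k = 0 then 1 else 0)"
  by (cases k) (simp_all add: shifted_binomial_sum_def)

text \<open>Pascal's rule for \<open>Suc m choose i\<close>, with the index shifted in the second
  sum.\<close>

lemma shifted_binomial_sum_split:
  "shifted_binomial_sum x (Suc m) k =
    (\<Sum>i\<le>m. of_nat ((m choose i) * (Suc m choose (k + i))) * x ^ i) +
    x * (\<Sum>i\<le>m. of_nat ((m choose i) * (Suc m choose (Suc k + i))) * x ^ i)"
proof -
  \<comment> \<open>The case \<open>i = 0\<close> is separate because \<open>i - 1\<close> is
    truncated to \<open>0\<close> there.\<close>
  let ?B = "\<lambda>i. of_nat ((if i = 0 then 0 else m choose (i - 1)) * (Suc m choose (k + i))) * x ^ i"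
  have "shifted_binomial_sum x (Suc m) k =
      (\<Sum>i\<le>Suc m. of_nat ((m choose i) * (Suc m choose (k + i))) * x ^ i + ?B i)"
    unfolding shifted_binomial_sum_def
  proof (intro sum.cong refl)
    fix i
    show "of_nat ((Suc m choose i) * (Suc m choose (k + i))) * x ^ i =
        of_nat ((m choose i) * (Suc m choose (k + i))) * x ^ i + ?B i"
      by (cases i) (simp_all add: algebra_simps)
  qed
  also have "\<dots> = (\<Sum>i\<le>m. of_nat ((m choose i) * (Suc m choose (k + i))) * x ^ i) + (\<Sum>i\<le>Suc m. ?B i)"
    unfolding sum.distrib by (simp add: binomial_eq_0)
  also have "(\<Sum>i\<le>Suc m. ?B i) = x * (\<Sum>i\<le>m. of_nat ((m choose i) * (Suc m choose (Suc k + i))) * x ^ i)"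
    unfolding sum.atMost_Suc_shift by (simp add: sum_distrib_left mult_ac del: binomial_Suc_Suc)
  finally show ?thesis .
qed

lemma shifted_binomial_sum_upper_Suc:
  "(\<Sum>i\<le>m. of_nat ((m choose i) * (Suc m choose (Suc k + i))) * x ^ i) =
    shifted_binomial_sum x m k + shifted_binomial_sum x m (Suc k)"
  by (simp add: shifted_binomial_sum_def sum.distrib algebra_simps)

text \<open>Compares coefficients when the \<open>m\<close>-th power of
  \<open>(1 + u) * (1 + x * u)\<close> is multiplied by
  \<open>1 + (1 + x) * u + x * u ^ 2\<close>.\<close>

lemma shifted_binomial_sum_Suc_Suc:
  fixes x :: "'a::comm_semiring_1"
  shows "shifted_binomial_sum x (Suc m) (Suc k) = shifted_binomial_sum x m k +
    (1 + x) * shifted_binomial_sum x m (Suc k) + x * shifted_binomial_sum x m (Suc (Suc k))"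
  unfolding shifted_binomial_sum_split shifted_binomial_sum_upper_Suc
  by (simp add: algebra_simps)

text \<open>Here the coefficient of \<open>u ^ (m + 1)\<close> in the \<open>m\<close>-th power also
  enters. By the symmetry of that power it is \<open>x\<close> times the coefficient of
  \<open>u ^ (m - 1)\<close>, whence the factor 2.\<close>

lemma shifted_binomial_sum_Suc_0:
  fixes x :: "'a::comm_semiring_1"
  shows "shifted_binomial_sum x (Suc m) 0 =
    (1 + x) * shifted_binomial_sum x m 0 + 2 * x * shifted_binomial_sum x m 1"
proof -
  let ?B = "\<lambda>i. of_nat ((m choose i) * (if i = 0 then 0 else m choose (i - 1))) * x ^ i"
  have "(\<Sum>i\<le>m. of_nat ((m choose i) * (Suc m choose i)) * x ^ i) =
      (\<Sum>i\<le>Suc m. of_nat ((m choose i) * (m choose i)) * x ^ i + ?B i)"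
  proof -
    have "of_nat ((m choose i) * (Suc m choose i)) * x ^ i =
        of_nat ((m choose i) * (m choose i)) * x ^ i + ?B i" for i
      by (cases i) (simp_all add: algebra_simps)
    then show ?thesis by (simp add: binomial_eq_0)
  qed
  also have "\<dots> = shifted_binomial_sum x m 0 + (\<Sum>i\<le>Suc m. ?B i)"
    by (simp add: sum.distrib shifted_binomial_sum_def binomial_eq_0)
  \<comment> \<open>The symmetry appears as the shift of \<open>i\<close>, which exchanges the roles
    of the two binomial coefficients.\<close>
  also have "(\<Sum>i\<le>Suc m. ?B i) = x * shifted_binomial_sum x m 1"
    unfolding sum.atMost_Suc_shift
    by (simp add: shifted_binomial_sum_def sum_distrib_left mult_ac del: binomial_Suc_Suc)
  finally show ?thesis
    using shifted_binomial_sum_split[of x m 0] shifted_binomial_sum_upper_Suc[of m 0 x]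
    by (simp add: algebra_simps mult_2)
qed

lemma poly_narayana_B_poly:
  "poly (narayana_B_poly (Suc m)) x = shifted_binomial_sum x m 0"
  by (simp add: narayana_B_poly_def shifted_binomial_sum_def poly_sum poly_monom power2_eq_square
      lessThan_Suc_atMost)

lemma poly_narayana_poly:
  assumes "m > 0"
  shows "poly (narayana_poly m) x = shifted_binomial_sum x m 1 / of_nat m"
proof -
  have "shifted_binomial_sum x m 1 = (\<Sum>i<m. of_nat ((m choose i) * (m choose Suc i)) * x ^ i)"
    unfolding shifted_binomial_sum_def by (simp add: lessThan_Suc_atMost[symmetric])
  then show ?thesis
    by (simp add: narayana_poly_def poly_sum poly_monom sum_divide_distrib)
qed

text \<open>The equation has the Lagrange form \<open>N = fps_X * \<phi>(N)\<close> with
  \<open>\<phi>(u) = (1 + u) * (1 + x * u)\<close>; the coefficients of \<open>N\<close> are found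
  from it alone.\<close>

locale narayana_series =
  fixes x :: "'a::field_char_0" and N :: "'a fps"
  assumes N_eq: "N = fps_X * ((1 + N) * (1 + fps_const x * N))"
begin

text \<open>The denominator is \<open>1 - fps_X * \<phi>'(N)\<close>, as it arises on
  differentiating \<open>N = fps_X * \<phi>(N)\<close>. By \<open>X_mult_deriv_N\<close> below, this
  is the series \<open>y N' / N\<close>.\<close>

definition S :: "'a fps" where
  "S = inverse (1 - fps_X * (fps_const (1 + x) + fps_const (2 * x) * N))"

lemma N_nth_0 [simp]: "N $ 0 = 0"
  by (subst N_eq) simp

lemma N_eq': "N = fps_X * (1 + fps_const (1 + x) * N + fps_const x * N\<^sup>2)"
  by (subst N_eq) (simp add: power2_eq_square algebra_simps flip: fps_const_add)

lemma S_mult: "S * (1 - fps_X * (fps_const (1 + x) + fps_const (2 * x) * N)) = 1"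
  unfolding S_def by (rule inverse_mult_eq_1) simp

lemma S_eq: "S = 1 + fps_X * (fps_const (1 + x) * S + fps_const (2 * x) * (S * N))"
  using S_mult by (simp add: algebra_simps)

lemma S_nth_0 [simp]: "S $ 0 = 1"
  by (subst S_eq) simp

text \<open>
  Lagrange inversion for the series \<open>N\<close>: both sides satisfy the recursion of
  \<open>shifted_binomial_sum\<close> in \<open>m\<close> for all \<open>k\<close> simultaneously.
\<close>

lemma S_N_power_nth: "(S * N ^ k) $ m = shifted_binomial_sum x m k"
proof (induction m arbitrary: k)
  case 0
  then show ?case by (simp add: shifted_binomial_sum_0 fps_power_zeroth)
next
  case (Suc m)
  show ?case
  proof (cases k)
    case 0
    \<comment> \<open>For \<open>k = 0\<close> the recursion, including its factor 2, comes from the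
      equation \<open>S_eq\<close> for \<open>S\<close>.\<close>
    have "(S * N ^ k) $ Suc m =
      (1 + fps_X * (fps_const (1 + x) * (S * N ^ 0) + fps_const (2 * x) * (S * N ^ 1))) $ Suc m"
      using S_eq 0 by simp
    also have "\<dots> = (1 + x) * (S * N ^ 0) $ m + 2 * x * (S * N ^ 1) $ m"
      by (simp del: power_0 power_one_right)
    finally show ?thesis
      unfolding Suc 0 shifted_binomial_sum_Suc_0 .
  next
    case k: (Suc k')
    \<comment> \<open>For \<open>k > 0\<close> one factor \<open>N\<close> is replaced by the
      right-hand side of \<open>N_eq'\<close>.\<close>
    have "S * N ^ k = S * N ^ k' * N" unfolding k by (simp add: mult_ac)
    also have "\<dots> = S * N ^ k' * (fps_X * (1 + fps_const (1 + x) * N + fps_const x * N\<^sup>2))"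
      using N_eq' by simp
    also have "\<dots> = fps_X * (S * N ^ k' + fps_const (1 + x) * (S * N ^ Suc k') +
        fps_const x * (S * N ^ Suc (Suc k')))"
      by (simp add: algebra_simps power2_eq_square)
    finally have "S * N ^ k = \<dots>" .
    then have "(S * N ^ k) $ Suc m = (S * N ^ k') $ m + (1 + x) * (S * N ^ Suc k') $ m +
        x * (S * N ^ Suc (Suc k')) $ m"
      by (simp del: power_Suc)
    then show ?thesis
      unfolding Suc k shifted_binomial_sum_Suc_Suc .
  qed
qed

text \<open>Differentiating \<open>N_eq'\<close> gives a linear equation for
  \<open>fps_X * fps_deriv N\<close> with coefficient \<open>1 - fps_X * \<phi>'(N)\<close>;
  multiplying by \<open>S\<close> solves it.\<close>

lemma X_mult_deriv_N: "fps_X * fps_deriv N = S * N"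
proof -
  let ?c = "fps_const (1 + x) + fps_const (2 * x) * N"
  let ?D = "1 - fps_X * ?c" and ?Q = "fps_X * fps_deriv N"
  have "fps_deriv N = (1 + fps_const (1 + x) * N + fps_const x * N\<^sup>2) + ?c * ?Q"
    by (subst N_eq')
      (simp add: power2_eq_square algebra_simps flip: fps_const_mult fps_numeral_fps_const)
  then have "?Q = N + fps_X * (?c * ?Q)"
    using N_eq' by (metis distrib_left)
  then have "?Q - fps_X * (?c * ?Q) = N"
    unfolding diff_eq_eq .
  then have "?D * ?Q = N"
    by (simp only: left_diff_distrib mult_1 mult.assoc)
  then have "S * ?D * (fps_X * fps_deriv N) = S * N" by (simp add: mult.assoc)
  then show ?thesis unfolding S_mult by simp
qed

text \<open>Compares coefficients in \<open>X_mult_deriv_N\<close>, whose left side contributes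
  \<open>of_nat m * N $ m\<close>.\<close>

lemma N_nth: "m > 0 \<Longrightarrow> N $ m = shifted_binomial_sum x m 1 / of_nat m"
proof -
  assume m: "m > 0"
  have "of_nat m * N $ m = (fps_X * fps_deriv N) $ m"
    using m by (cases m) simp_all
  also have "\<dots> = shifted_binomial_sum x m 1"
    unfolding X_mult_deriv_N using S_N_power_nth[of 1 m] by simp
  finally show ?thesis using m by (simp add: field_simps)
qed

lemma S_nth: "S $ m = shifted_binomial_sum x m 0"
  using S_N_power_nth[of 0 m] by simp

text \<open>Substituting \<open>N_eq\<close> into \<open>X_mult_deriv_N\<close> allows
  \<open>fps_X\<close> to be cancelled; the result is the Riccati equation for
  \<open>1 + N\<close>.\<close>

lemma deriv_N: "fps_deriv N = (1 + N) * (1 + fps_const x * N) * S"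
proof -
  have "fps_X * fps_deriv N = fps_X * ((1 + N) * (1 + fps_const x * N) * S)"
    unfolding X_mult_deriv_N using N_eq by (metis mult.assoc mult.commute)
  then show ?thesis by simp
qed

end

section \<open>Uniqueness of solutions of differential equations\<close>

lemma fps_linear_ode_zero:
  fixes D W :: "'a::field_char_0 fps"
  assumes "fps_deriv D = D * W" "D $ 0 = 0"
  shows "D = 0"
proof -
  have "D $ n = 0" for n
  proof (induction n rule: less_induct)
    case (less n)
    show ?case
    proof (cases n)
      case (Suc m)
      \<comment> \<open>The next coefficient of \<open>D\<close> is a combination of earlier ones,
        which vanish by induction.\<close>
      have "of_nat (Suc m) * D $ Suc m = (D * W) $ m"
        using arg_cong[OF assms(1), of "\<lambda>f. f $ m"] by simp
      also have "\<dots> = 0" using less Suc by (simp add: fps_mult_nth)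
      finally show ?thesis using Suc by (simp del: of_nat_Suc)
    qed (use assms in simp)
  qed
  then show ?thesis by (simp add: fps_eq_iff)
qed

text \<open>Since \<open>P * (a * P + b) - Q * (a * Q + b)\<close> has the factor
  \<open>P - Q\<close>, the difference of two solutions solves a linear homogeneous
  equation.\<close>

lemma fps_riccati_unique:
  fixes P Q S :: "'a::field_char_0 fps"
  assumes "fps_deriv P = P * (a * P + b) * S" "fps_deriv Q = Q * (a * Q + b) * S" "P $ 0 = Q $ 0"
  shows "P = Q"
proof -
  have "fps_deriv (P - Q) = (P - Q) * ((a * (P + Q) + b) * S)"
    using assms(1,2) by (simp add: algebra_simps)
  from fps_linear_ode_zero[OF this] show ?thesis using assms(3) by simp
qed

section \<open>The exponential formula for cycles\<close>

text \<open>For \<open>a\<close> in a finite \<open>X\<close> these are the permutations of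
  \<open>X\<close> with a single cycle; the base point \<open>a\<close> marks the cycle that is
  split off below.\<close>

definition full_cycles :: "'a set \<Rightarrow> 'a \<Rightarrow> ('a \<Rightarrow> 'a) set" where
  "full_cycles X a = {\<sigma>. \<sigma> permutes X \<and> orbit \<sigma> a = X}"

lemma self_in_orbit_permutes: "finite A \<Longrightarrow> p permutes A \<Longrightarrow> x \<in> orbit p x"
  by (rule permutation_self_in_orbit) (auto simp: permutation_permutes)

lemma orbit_comp_disjoint:
  assumes "\<sigma> permutes X" "q permutes Y" "X \<inter> Y = {}"
  shows "x \<in> X \<Longrightarrow> orbit (\<sigma> \<circ> q) x = orbit \<sigma> x" "x \<in> Y \<Longrightarrow> orbit (\<sigma> \<circ> q) x = orbit q x"
proof -
  have q: "q y = y" if "y \<in> X" for y using that assms by (metis disjoint_iff permutes_not_in)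
  have s: "\<sigma> y = y" if "y \<in> Y" for y using that assms by (metis disjoint_iff permutes_not_in)
  show "orbit (\<sigma> \<circ> q) x = orbit \<sigma> x" if "x \<in> X"
    using that assms(1) q
    by (intro orbit_cong0[of x X]) (auto simp: permutes_in_image)
  show "orbit (\<sigma> \<circ> q) x = orbit q x" if "x \<in> Y"
    using that assms(2) s
    by (intro orbit_cong0[of x Y]) (auto simp: permutes_in_image)
qed

text \<open>A permutation preserves the orbit \<open>Y\<close> of \<open>a\<close> and its
  complement; its restrictions to these two sets are the factors, and composing them recovers
  it.\<close>

lemma bij_betw_split_cycle:
  assumes "finite X" "a \<in> Y" "Y \<subseteq> X"
  shows "bij_betw (\<lambda>(\<sigma>, q). \<sigma> \<circ> q) (full_cycles Y a \<times> {q. q permutes X - Y})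
    {p. p permutes X \<and> orbit p a = Y}"
proof (rule bij_betwI[where g = "\<lambda>p. (perm_restrict p Y, perm_restrict p (X - Y))"])
  have disj: "Y \<inter> (X - Y) = {}" and un: "Y \<union> (X - Y) = X" using assms by auto
  show "(\<lambda>(\<sigma>, q). \<sigma> \<circ> q) \<in> full_cycles Y a \<times> {q. q permutes X - Y} \<rightarrow>
      {p. p permutes X \<and> orbit p a = Y}"
  proof safe
    fix \<sigma> q assume s: "\<sigma> \<in> full_cycles Y a" and q: "q permutes X - Y"
    then have s': "\<sigma> permutes Y" "orbit \<sigma> a = Y" by (auto simp: full_cycles_def)
    then have "\<sigma> permutes X" "q permutes X"
      using q assms(3) by (auto intro: permutes_subset)
    then show "\<sigma> \<circ> q permutes X" by (rule permutes_compose[rotated])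
    have "orbit (\<sigma> \<circ> q) a = Y" using orbit_comp_disjoint(1)[OF s'(1) q disj assms(2)] s'(2) by simp
    then show "x \<in> orbit (\<sigma> \<circ> q) a \<Longrightarrow> x \<in> Y" "x \<in> Y \<Longrightarrow> x \<in> orbit (\<sigma> \<circ> q) a" for x by simp_all
  qed
  show "(\<lambda>p. (perm_restrict p Y, perm_restrict p (X - Y))) \<in> {p. p permutes X \<and> orbit p a = Y} \<rightarrow>
      full_cycles Y a \<times> {q. q permutes X - Y}"
  proof
    fix p assume "p \<in> {p. p permutes X \<and> orbit p a = Y}"
    then have p: "p permutes X" "orbit p a = Y" by auto
    have cyc: "cyclic_on p Y" using cyclic_on_orbit[OF p(1) assms(1), of a] p(2) by simp
    have "p ` Y \<subseteq> Y" using cyc by (auto dest: cyclic_on_inI)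
    moreover have "inj_on p Y" using p(1) by (rule permutes_inj_on)
    ultimately have "bij_betw p Y Y"
      using assms finite_subset[OF assms(3,1)] by (simp add: bij_betw_def endo_inj_surj)
    then have "bij_betw (perm_restrict p Y) Y Y"
      by (rule bij_betw_cong[THEN iffD1, rotated]) (simp add: perm_restrict_simps)
    then have "perm_restrict p Y permutes Y"
      by (rule bij_imp_permutes) (simp add: perm_restrict_simps)
    moreover have "orbit (perm_restrict p Y) a = Y"
    proof -
      have "orbit (perm_restrict p Y) a = orbit p a"
        by (rule orbit_cong) (use p assms(2) in \<open>auto simp: perm_restrict_simps\<close>)
      with p(2) show ?thesis by simp
    qed
    moreover have "perm_restrict p (X - Y) permutes X - Y"
      using p(1) cyc by (rule perm_restrict_diff_cyclic)
    ultimately show "(perm_restrict p Y, perm_restrict p (X - Y)) \<in>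
        full_cycles Y a \<times> {q. q permutes X - Y}"
      by (simp add: full_cycles_def)
  qed
  show "(case (perm_restrict p Y, perm_restrict p (X - Y)) of (\<sigma>, q) \<Rightarrow> \<sigma> \<circ> q) = p"
    if "p \<in> {p. p permutes X \<and> orbit p a = Y}" for p
  proof -
    have p: "p permutes X" "orbit p a = Y" using that by auto
    have cyc: "cyclic_on p Y" using cyclic_on_orbit[OF p(1) assms(1), of a] p(2) by simp
    have "perm_restrict p Y (perm_restrict p (X - Y) x) = p x" for x
    proof (cases "x \<in> X - Y")
      case True
      then have "p x \<notin> Y" using cyclic_on_f_in[OF p(1) cyc] by auto
      with True show ?thesis by (simp add: perm_restrict_simps)
    next
      case False
      then show ?thesis using p(1)
        by (cases "x \<in> Y") (auto simp: perm_restrict_simps permutes_not_in)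
    qed
    then show ?thesis by (simp add: fun_eq_iff)
  qed
  show "(\<lambda>p. (perm_restrict p Y, perm_restrict p (X - Y))) (case s of (\<sigma>, q) \<Rightarrow> \<sigma> \<circ> q) = s"
    if "s \<in> full_cycles Y a \<times> {q. q permutes X - Y}" for s
  proof -
    obtain \<sigma> q where sq: "s = (\<sigma>, q)" by fastforce
    with that have s: "s = (\<sigma>, q)" "\<sigma> permutes Y" "q permutes X - Y"
      by (auto simp: full_cycles_def)
    have "perm_restrict (\<sigma> \<circ> q) Y x = \<sigma> x" for x
      using s(2,3) by (cases "x \<in> Y") (auto simp: perm_restrict_simps permutes_not_in)
    moreover have "perm_restrict (\<sigma> \<circ> q) (X - Y) x = q x" for x
    proof (cases "x \<in> X - Y")
      case True
      then have "q x \<in> X - Y" using permutes_in_image[OF s(3)] by blast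
      with True s(2) show ?thesis by (auto simp: perm_restrict_simps permutes_not_in)
    qed (use s(3) in \<open>simp add: perm_restrict_simps permutes_not_in\<close>)
    ultimately show ?thesis using s(1) by (simp add: fun_eq_iff)
  qed
qed

text \<open>Groups the permutations by the set \<open>C\<close> of the other elements on the cycle
  of \<open>a\<close>. The weight \<open>G\<close> sees only supports, so the cycles on
  \<open>insert a C\<close> enter through their number.\<close>

lemma sum_permutes_split_cycle:
  fixes G :: "'b set set \<Rightarrow> 'a::comm_semiring_1"
  assumes "finite A" "a \<notin> A"
  shows "(\<Sum>p | p permutes insert a A. G (orbit p ` insert a A)) =
    (\<Sum>C\<in>Pow A. of_nat (card (full_cycles (insert a C) a)) *
      (\<Sum>q | q permutes A - C. G (insert (insert a C) (orbit q ` (A - C)))))"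
proof -
  let ?X = "insert a A"
  let ?P = "{p. p permutes ?X}"
  have fin: "finite ?P" using assms by (simp add: finite_permutations)
  have orb: "orbit p a - {a} = C \<longleftrightarrow> orbit p a = insert a C" if "p \<in> ?P" "C \<in> Pow A" for p C
    using self_in_orbit_permutes[of ?X p a] assms that by auto
  have "(\<Sum>p\<in>?P. G (orbit p ` ?X)) =
      (\<Sum>C\<in>Pow A. \<Sum>p\<in>{p \<in> ?P. orbit p a - {a} = C}. G (orbit p ` ?X))"
    using fin assms permutes_orbit_subset[of _ ?X a] by (intro sum.group[symmetric]) auto
  also have "\<dots> = (\<Sum>C\<in>Pow A. of_nat (card (full_cycles (insert a C) a)) *
      (\<Sum>q | q permutes A - C. G (insert (insert a C) (orbit q ` (A - C)))))"
  proof (intro sum.cong refl)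
    fix C assume C: "C \<in> Pow A"
    let ?Y = "insert a C"
    have diff: "?X - ?Y = A - C" using assms by auto
    have "{p \<in> ?P. orbit p a - {a} = C} = {p. p permutes ?X \<and> orbit p a = ?Y}"
      using orb C by blast
    moreover have bij: "bij_betw (\<lambda>(\<sigma>, q). \<sigma> \<circ> q) (full_cycles ?Y a \<times> {q. q permutes A - C})
        {p. p permutes ?X \<and> orbit p a = ?Y}"
      using bij_betw_split_cycle[of ?X a ?Y] assms C unfolding diff by auto
    ultimately have "(\<Sum>p\<in>{p \<in> ?P. orbit p a - {a} = C}. G (orbit p ` ?X)) =
        (\<Sum>s\<in>full_cycles ?Y a \<times> {q. q permutes A - C}. G (orbit (case s of (\<sigma>, q) \<Rightarrow> \<sigma> \<circ> q) ` ?X))"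
      using sum.reindex_bij_betw[OF bij, of "\<lambda>p. G (orbit p ` ?X)"] by simp
    also have "\<dots> = (\<Sum>(\<sigma>, q)\<in>full_cycles ?Y a \<times> {q. q permutes A - C}.
        G (insert ?Y (orbit q ` (A - C))))"
    proof (intro sum.cong refl, clarify)
      fix \<sigma> q assume s: "\<sigma> \<in> full_cycles ?Y a" and q: "q permutes A - C"
      then have s': "\<sigma> permutes ?Y" "orbit \<sigma> a = ?Y" by (auto simp: full_cycles_def)
      have disj: "?Y \<inter> (A - C) = {}" using assms by auto
      have "orbit \<sigma> x = ?Y" if "x \<in> ?Y" for x
      proof -
        have "cyclic_on \<sigma> ?Y"
          using cyclic_on_orbit[OF s'(1), of a] s'(2) assms C finite_subset[of C A] by simp
        then show ?thesis using that by (rule orbit_cyclic_eq3)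
      qed
      then have "orbit (\<sigma> \<circ> q) ` ?Y = {?Y}"
        using orbit_comp_disjoint(1)[OF s'(1) q disj] by auto
      moreover have "orbit (\<sigma> \<circ> q) ` (A - C) = orbit q ` (A - C)"
        using orbit_comp_disjoint(2)[OF s'(1) q disj] by auto
      moreover have "?X = ?Y \<union> (A - C)" using C by auto
      ultimately have "orbit (\<sigma> \<circ> q) ` ?X = insert ?Y (orbit q ` (A - C))"
        by (metis image_Un insert_is_Un)
      then show "G (orbit (\<sigma> \<circ> q) ` ?X) = G (insert ?Y (orbit q ` (A - C)))" by simp
    qed
    also have "\<dots> = of_nat (card (full_cycles ?Y a)) *
        (\<Sum>q | q permutes A - C. G (insert ?Y (orbit q ` (A - C))))"
      unfolding sum.cartesian_product[symmetric] by simp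
    finally show "(\<Sum>p\<in>{p \<in> ?P. orbit p a - {a} = C}. G (orbit p ` ?X)) = \<dots>" .
  qed
  finally show ?thesis .
qed

text \<open>
  Taking \<open>G = 1\<close> in the previous lemma expresses \<open>fact (Suc n)\<close> through the numbers of full cycles,
  so these are determined recursively.
\<close>

lemma card_full_cycles:
  assumes "finite A" "a \<notin> A"
  shows "card (full_cycles (insert a A) a) = fact (card A)"
  using assms
proof (induction rule: finite_psubset_induct)
  case (psubset A)
  let ?n = "card A"
  have pow: "Pow A = insert A (Pow A - {A})" by auto
  have "fact (Suc ?n) = (\<Sum>p | p permutes insert a A. 1 :: nat)"
    using psubset by (simp add: card_permutations[of "insert a A" "Suc ?n"])
  also have "\<dots> = (\<Sum>C\<in>Pow A. card (full_cycles (insert a C) a) * fact (?n - card C))"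
    unfolding sum_permutes_split_cycle[OF psubset.hyps psubset.prems, of "\<lambda>_. 1 :: nat"]
    using psubset.hyps
    by (intro sum.cong refl)
      (auto simp: card_permutations[OF refl] card_Diff_subset finite_subset)
  also have "\<dots> = card (full_cycles (insert a A) a) +
      (\<Sum>C\<in>Pow A - {A}. card (full_cycles (insert a C) a) * fact (?n - card C))"
    using psubset.hyps by (subst pow, subst sum.insert) auto
  also have "(\<Sum>C\<in>Pow A - {A}. card (full_cycles (insert a C) a) * fact (?n - card C)) =
      (\<Sum>C\<in>Pow A - {A}. fact (card C) * fact (?n - card C))"
    using psubset by (intro sum.cong refl) (auto simp: psubset_eq)
  finally have 1: "fact (Suc ?n) = card (full_cycles (insert a A) a) +
      (\<Sum>C\<in>Pow A - {A}. fact (card C) * fact (?n - card C))" .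
  \<comment> \<open>The same sum with the claimed value also in the term \<open>C = A\<close> equals
    \<open>fact (Suc ?n)\<close> too; comparing the two isolates that term.\<close>
  have "fact (Suc ?n) = (\<Sum>j\<le>?n. fact ?n :: nat)" by simp
  also have "\<dots> = (\<Sum>j\<le>?n. (?n choose j) * (fact j * fact (?n - j)))"
    using binomial_fact_lemma[of _ ?n] by (intro sum.cong refl) (simp add: mult_ac)
  also have "\<dots> = (\<Sum>C\<in>Pow A. fact (card C) * fact (?n - card C))"
    using sum_Pow_card[OF psubset.hyps, of "\<lambda>j. fact j * fact (?n - j) :: nat"] by simp
  also have "\<dots> = fact ?n + (\<Sum>C\<in>Pow A - {A}. fact (card C) * fact (?n - card C))"
    using psubset.hyps by (subst pow, subst sum.insert) auto
  finally show ?case using 1 by simp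
qed

text \<open>Splitting off the cycle through one element mirrors the chain rule
  \<open>(F o L)' = L' (F' o L)\<close>: the coefficients of \<open>L'\<close> are the
  \<open>b (Suc j)\<close>, and \<open>F'\<close> belongs to the shifted sequence
  \<open>f (Suc l)\<close>. Hence the induction needs arbitrary \<open>f\<close>.\<close>

lemma exponential_formula_cycles:
  fixes b f :: "nat \<Rightarrow> 'a::field_char_0"
  assumes "finite A"
  shows "(\<Sum>p | p permutes A. (\<Prod>c\<in>orbit p ` A. b (card c)) * f (card (orbit p ` A))) =
    fact (card A) * (Abs_fps (\<lambda>l. f l / fact l) oo Abs_fps (\<lambda>m. if m = 0 then 0 else b m / of_nat m)) $ card A"
  using assms
proof (induction A arbitrary: f rule: finite_psubset_induct)
  case (psubset X)
  let ?L = "Abs_fps (\<lambda>m. if m = 0 then 0 else b m / of_nat m)"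
  let ?F = "\<lambda>f. Abs_fps (\<lambda>l. f l / fact l :: 'a)"
  let ?W = "\<lambda>f A. \<Sum>p | p permutes A. (\<Prod>c\<in>orbit p ` A. b (card c)) * f (card (orbit p ` A))"
  show ?case
  proof (cases "X = {}")
    case True
    then show ?thesis by simp
  next
    case False
    then obtain a A where X: "X = insert a A" "a \<notin> A" by (metis mk_disjoint_insert ex_in_conv)
    have A: "finite A" using psubset.hyps X by simp
    let ?n = "card A" and ?f = "\<lambda>l. f (Suc l)"
    let ?H = "?F ?f oo ?L"
    have "?W f X = (\<Sum>C\<in>Pow A. fact (card C) * (b (Suc (card C)) * ?W ?f (A - C)))"
      unfolding X sum_permutes_split_cycle[OF A X(2), of "\<lambda>Q. (\<Prod>c\<in>Q. b (card c)) * f (card Q)"]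
    proof (intro sum.cong refl)
      fix C assume C: "C \<in> Pow A"
      then have finC: "finite C" "a \<notin> C" using A X(2) by (auto intro: finite_subset)
      have "(\<Prod>c\<in>insert (insert a C) (orbit q ` (A - C)). b (card c)) *
          f (card (insert (insert a C) (orbit q ` (A - C)))) =
          b (Suc (card C)) * ((\<Prod>c\<in>orbit q ` (A - C). b (card c)) * ?f (card (orbit q ` (A - C))))"
        if q: "q permutes A - C" for q
      proof -
        \<comment> \<open>The support containing \<open>a\<close> is new, so the product gains one
          factor and the number of cycles grows by one.\<close>
        have "insert a C \<notin> orbit q ` (A - C)"
          using permutes_orbit_subset[OF q] X(2) by blast
        then show ?thesis using A finC by (simp add: mult_ac)
      qed
      then have "(\<Sum>q | q permutes A - C. (\<Prod>c\<in>insert (insert a C) (orbit q ` (A - C)). b (card c)) *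
          f (card (insert (insert a C) (orbit q ` (A - C))))) = b (Suc (card C)) * ?W ?f (A - C)"
        by (simp add: sum_distrib_left)
      then show "of_nat (card (full_cycles (insert a C) a)) *
        (\<Sum>q | q permutes A - C. (\<Prod>c\<in>insert (insert a C) (orbit q ` (A - C)). b (card c)) *
          f (card (insert (insert a C) (orbit q ` (A - C))))) =
        fact (card C) * (b (Suc (card C)) * ?W ?f (A - C))"
        by (simp add: card_full_cycles[OF finC])
    qed
    also have "\<dots> = (\<Sum>C\<in>Pow A. fact (card C) * (b (Suc (card C)) * (fact (?n - card C) * ?H $ (?n - card C))))"
    proof (intro sum.cong refl)
      fix C assume C: "C \<in> Pow A"
      then have "A - C \<subset> X" "card (A - C) = ?n - card C"
        using X A by (auto simp: card_Diff_subset finite_subset)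
      then show "fact (card C) * (b (Suc (card C)) * ?W ?f (A - C)) =
          fact (card C) * (b (Suc (card C)) * (fact (?n - card C) * ?H $ (?n - card C)))"
        using psubset.IH[of "A - C" ?f] by simp
    qed
    also have "\<dots> = (\<Sum>j\<le>?n. of_nat (?n choose j) * (fact j * (b (Suc j) * (fact (?n - j) * ?H $ (?n - j)))))"
      by (rule sum_Pow_card[OF A])
    also have "\<dots> = (\<Sum>j\<le>?n. fact ?n * (b (Suc j) * ?H $ (?n - j)))"
      by (intro sum.cong refl) (simp add: binomial_fact)
    also have "\<dots> = fact ?n * (fps_deriv ?L * ?H) $ ?n"
      by (simp add: fps_mult_nth sum_distrib_left atLeast0AtMost del: of_nat_Suc)
    also have "fps_deriv (?F f) = ?F ?f"
      by (simp add: fps_eq_iff field_simps del: of_nat_Suc)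
    then have "fps_deriv ?L * ?H = fps_deriv (?F f oo ?L)"
      by (subst fps_compose_deriv) simp_all
    also have "fact ?n * fps_deriv (?F f oo ?L) $ ?n = fact (card X) * (?F f oo ?L) $ card X"
      using X A by (simp add: mult_ac)
    finally show ?thesis .
  qed
qed

section \<open>Composition with the cycle series\<close>

definition narayana2_egf :: "rat \<Rightarrow> nat \<Rightarrow> rat fps" where
  "narayana2_egf x n = Abs_fps (\<lambda>k. poly (narayana2_poly n k) x / fact k)"

text \<open>\<open>narayana2_poly m 0\<close> enumerates the permutations sorted by one pass. The
  constant term is 0, as the functional equation requires, although
  \<open>narayana2_poly 0 0\<close> is 1.\<close>

definition narayana_ogf :: "rat \<Rightarrow> rat fps" where
  "narayana_ogf x = Abs_fps (\<lambda>m. if m = 0 then 0 else poly (narayana2_poly m 0) x)"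

definition cycle_series :: "rat \<Rightarrow> rat fps" where
  "cycle_series x = Abs_fps (\<lambda>m. if m = 0 then 0 else poly (narayana_B_poly m) x / of_nat m)"

lemma egf_mult_nth:
  fixes f g :: "nat \<Rightarrow> 'a::field_char_0"
  shows "(Abs_fps (\<lambda>k. f k / fact k) * Abs_fps (\<lambda>k. g k / fact k)) $ k =
    (\<Sum>j\<le>k. of_nat (k choose j) * (f j * g (k - j))) / fact k"
  unfolding fps_mult_nth sum_divide_distrib atLeast0AtMost
  by (intro sum.cong refl) (simp add: binomial_fact)

lemma fps_deriv_narayana2_egf_0: "fps_deriv (narayana2_egf x 0) = narayana2_egf x 1"
  by (simp add: fps_eq_iff narayana2_egf_def narayana2_poly_0_Suc field_simps del: of_nat_Suc)

text \<open>The case \<open>n = 0\<close> of the recursion. An empty right part has weight 1 and any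
  other carries \<open>x\<close>, which turns its series \<open>F\<close> into
  \<open>x * F + 1 - x\<close>.\<close>

lemma narayana2_egf_1:
  "narayana2_egf x 1 = (fps_const x * narayana2_egf x 0 + fps_const (1 - x)) * narayana2_egf x 0"
proof (rule fps_ext)
  fix k
  let ?f = "\<lambda>j. poly (narayana2_poly 0 j) x * (if j = 0 then 1 else x)"
  let ?g = "\<lambda>j. poly (narayana2_poly 0 j) x"
  have "poly (narayana2_poly 1 k) x = (\<Sum>j\<le>k. of_nat (k choose j) * (?f j * ?g (k - j)))"
    using narayana2_poly_Suc[of 0 k x] by (simp add: mult_ac)
  then have "narayana2_egf x 1 $ k = (Abs_fps (\<lambda>k. ?f k / fact k) * Abs_fps (\<lambda>k. ?g k / fact k)) $ k"
    unfolding egf_mult_nth by (simp add: narayana2_egf_def)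
  also have "Abs_fps (\<lambda>k. ?f k / fact k) = fps_const x * narayana2_egf x 0 + fps_const (1 - x)"
    by (auto simp: fps_eq_iff narayana2_egf_def narayana2_poly_0_0)
  finally show "narayana2_egf x 1 $ k =
      ((fps_const x * narayana2_egf x 0 + fps_const (1 - x)) * narayana2_egf x 0) $ k"
    by (simp add: narayana2_egf_def)
qed

text \<open>The series \<open>1 + x N\<close> enumerates the possible right parts without small
  letters, together with the descent that precedes a nonempty one.\<close>

lemma narayana2_weight_eq:
  "poly (narayana2_poly i 0) x * (if i = 0 then 1 else x) = (1 + fps_const x * narayana_ogf x) $ i"
  by (simp add: narayana_ogf_def narayana2_poly_0_0)

text \<open>As \<open>n > 0\<close>, the right part is never empty in the first family, so the
  factor \<open>x\<close> is always present there.\<close>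

lemma narayana2_egf_Suc:
  assumes "n > 0"
  shows "narayana2_egf x (Suc n) = fps_const x * (narayana2_egf x n * narayana2_egf x 0) +
    (\<Sum>i\<in>{1..n}. fps_const ((1 + fps_const x * narayana_ogf x) $ (n - i)) * narayana2_egf x i)"
proof (rule fps_ext)
  fix k
  let ?f = "\<lambda>j. poly (narayana2_poly n j) x"
  let ?g = "\<lambda>j. poly (narayana2_poly 0 j) x"
  let ?K = "1 + fps_const x * narayana_ogf x"
  have 1: "(\<Sum>j\<le>k. of_nat (k choose j) * (?g (k - j) * ?f j * (if j = 0 \<and> n = 0 then 1 else x))) =
      x * (\<Sum>j\<le>k. of_nat (k choose j) * (?f j * ?g (k - j)))"
    using assms by (simp add: sum_distrib_left mult_ac)
  have 2: "(\<Sum>i\<in>{1..n}. poly (narayana2_poly i k) x * poly (narayana2_poly (n - i) 0) x *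
      (if i = n then 1 else x)) =
      (\<Sum>i\<in>{1..n}. ?K $ (n - i) * poly (narayana2_poly i k) x)"
    unfolding narayana2_weight_eq[symmetric] by (intro sum.cong refl) auto
  define A where "A = (\<Sum>j\<le>k. of_nat (k choose j) * (?f j * ?g (k - j)))"
  define c where "c i = ?K $ i" for i
  have A: "(narayana2_egf x n * narayana2_egf x 0) $ k = A / fact k"
    unfolding narayana2_egf_def A_def by (rule egf_mult_nth)
  have "narayana2_egf x (Suc n) $ k =
      (x * A + (\<Sum>i\<in>{1..n}. c (n - i) * poly (narayana2_poly i k) x)) / fact k"
    unfolding A_def c_def 1[symmetric] 2[symmetric] narayana2_egf_def fps_nth_Abs_fps narayana2_poly_Suc ..
  also have "\<dots> = x * (A / fact k) + (\<Sum>i\<in>{1..n}. c (n - i) * narayana2_egf x i $ k)"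
    by (simp add: narayana2_egf_def add_divide_distrib sum_divide_distrib)
  also have "\<dots> = (fps_const x * (narayana2_egf x n * narayana2_egf x 0) +
      (\<Sum>i\<in>{1..n}. fps_const (c (n - i)) * narayana2_egf x i)) $ k"
    using A by (simp add: fps_sum_nth)
  finally show "narayana2_egf x (Suc n) $ k = (fps_const x * (narayana2_egf x n * narayana2_egf x 0) +
      (\<Sum>i\<in>{1..n}. fps_const (?K $ (n - i)) * narayana2_egf x i)) $ k"
    unfolding c_def .
qed

text \<open>The recursion without small letters: an empty left part gives the first sum and the
  \<open>1\<close> in \<open>1 + N\<close>, a nonempty one gives the second sum and the
  \<open>N\<close>.\<close>

lemma narayana_ogf_eq:
  "narayana_ogf x = fps_X * ((1 + narayana_ogf x) * (1 + fps_const x * narayana_ogf x))"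
proof (rule fps_ext)
  fix m
  let ?N = "narayana_ogf x" and ?K = "1 + fps_const x * narayana_ogf x"
  show "?N $ m = (fps_X * ((1 + ?N) * ?K)) $ m"
  proof (cases m)
    case (Suc n)
    \<comment> \<open>The term for \<open>i = 0\<close> drops out because \<open>?N\<close> has
      constant term 0.\<close>
    have "(?N * ?K) $ n = (\<Sum>i\<in>{1..n}. ?N $ i * ?K $ (n - i))"
      unfolding fps_mult_nth
      by (subst sum.atLeast_Suc_atMost) (simp_all add: narayana_ogf_def)
    also have "\<dots> = (\<Sum>i\<in>{1..n}. poly (narayana2_poly i 0) x * poly (narayana2_poly (n - i) 0) x *
        (if i = n then 1 else x))"
      unfolding narayana2_weight_eq[symmetric] by (intro sum.cong refl) (auto simp: narayana_ogf_def)
    finally have NK: "(?N * ?K) $ n = \<dots>" .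
    have "?N $ m = ?K $ n + (?N * ?K) $ n"
      unfolding NK narayana2_weight_eq[symmetric] using narayana2_poly_Suc[of n 0 x] Suc
      by (simp add: narayana_ogf_def narayana2_poly_0_0)
    also have "\<dots> = ((1 + ?N) * ?K) $ n" unfolding fps_add_nth[symmetric] by (simp add: distrib_right)
    finally show ?thesis using Suc by simp
  qed (simp add: narayana_ogf_def)
qed

lemma narayana_series_ogf: "narayana_series x (narayana_ogf x)"
  by (rule narayana_series.intro) (rule narayana_ogf_eq)

lemma narayana_ogf_nth: "m > 0 \<Longrightarrow> narayana_ogf x $ m = poly (narayana_poly m) x"
  using narayana_series.N_nth[OF narayana_series_ogf] by (simp add: poly_narayana_poly)

lemma fps_deriv_cycle_series: "fps_deriv (cycle_series x) = narayana_series.S x (narayana_ogf x)"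
  by (simp add: fps_eq_iff cycle_series_def narayana_series.S_nth[OF narayana_series_ogf]
      poly_narayana_B_poly del: of_nat_Suc)

lemma cycle_series_nth_0 [simp]: "cycle_series x $ 0 = 0"
  by (simp add: cycle_series_def)

text \<open>The chain rule brings in \<open>fps_deriv (cycle_series x)\<close>, which is
  \<open>S\<close>, so both sides satisfy one Riccati equation with constant term 1.\<close>

lemma narayana2_egf_0_compose: "narayana2_egf x 0 oo cycle_series x = 1 + narayana_ogf x"
proof -
  let ?H = "narayana2_egf x 0 oo cycle_series x" and ?S = "narayana_series.S x (narayana_ogf x)"
  have "fps_deriv ?H = ?H * (fps_const x * ?H + fps_const (1 - x)) * ?S"
    unfolding fps_compose_deriv[OF cycle_series_nth_0] fps_deriv_narayana2_egf_0 narayana2_egf_1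
      fps_deriv_cycle_series
    by (simp add: fps_compose_mult_distrib fps_compose_add_distrib mult_ac)
  moreover have "fps_deriv (1 + narayana_ogf x) = (1 + narayana_ogf x) *
      (fps_const x * (1 + narayana_ogf x) + fps_const (1 - x)) * ?S"
  proof -
    have "fps_const x * (1 + narayana_ogf x) + fps_const (1 - x) = 1 + fps_const x * narayana_ogf x"
      by (simp add: algebra_simps flip: fps_const_sub)
    then show ?thesis using narayana_series.deriv_N[OF narayana_series_ogf, of x] by simp
  qed
  ultimately show ?thesis
    by (rule fps_riccati_unique) (simp add: narayana2_egf_def narayana_ogf_def narayana2_poly_0_0)
qed

text \<open>After composition, the two parts of the recursion are, by induction, the two pieces of
  the convolution of \<open>1 + x N\<close> with \<open>N\<close> cut at index \<open>m\<close>; the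
  functional equation evaluates the whole convolution.\<close>

lemma narayana2_egf_compose:
  assumes "n > 0"
  shows "narayana2_egf x n oo cycle_series x = Abs_fps (\<lambda>k. narayana_ogf x $ (n + k))"
  using assms
proof (induction n rule: less_induct)
  case (less n)
  let ?N = "narayana_ogf x" and ?L = "cycle_series x"
  let ?K = "1 + fps_const x * narayana_ogf x"
  let ?G = "\<lambda>n. Abs_fps (\<lambda>k. narayana_ogf x $ (n + k))"
  have N_Suc: "?N $ Suc m = ((1 + ?N) * ?K) $ m" for m
    by (subst narayana_ogf_eq) simp
  consider "n = 1" | m where "n = Suc m" "m > 0" using less.prems by (cases n) auto
  then show ?case
  proof cases
    case 1
    have "narayana2_egf x 1 oo ?L = (fps_const x * (1 + ?N) + fps_const (1 - x)) * (1 + ?N)"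
      unfolding narayana2_egf_1
      by (simp add: fps_compose_mult_distrib fps_compose_add_distrib narayana2_egf_0_compose)
    also have "\<dots> = (1 + ?N) * ?K"
      by (simp add: algebra_simps flip: fps_const_sub)
    finally show ?thesis using 1 N_Suc by (simp add: fps_eq_iff)
  next
    case (2 m)
    have IH: "narayana2_egf x i oo ?L = ?G i" if "i \<in> {1..m}" for i
      using less.IH[of i] that 2 by simp
    have "narayana2_egf x n oo ?L = fps_const x * (?G m * (1 + ?N)) +
        (\<Sum>i\<in>{1..m}. fps_const (?K $ (m - i)) * ?G i)"
      unfolding 2(1) narayana2_egf_Suc[OF 2(2)] using 2(2) IH
      by (simp add: fps_compose_mult_distrib fps_compose_add_distrib fps_compose_sum_distrib
          narayana2_egf_0_compose)
    also have "\<dots> = ?G n"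
    proof (rule fps_ext)
      fix k
      \<comment> \<open>The finite sum over \<open>i\<close> yields the indices
        \<open>s < m\<close>.\<close>
      have e1: "(\<Sum>i\<in>{1..m}. ?K $ (m - i) * ?N $ (i + k)) = (\<Sum>s<m. ?K $ s * ?N $ (m + k - s))"
        by (rule sum.reindex_bij_witness[where i = "\<lambda>s. m - s" and j = "\<lambda>i. m - i"])
          (auto simp: add.commute)
      \<comment> \<open>The product term yields the indices \<open>s \<ge> m\<close>, where
        \<open>m > 0\<close> ensures \<open>?K $ s = x * ?N $ s\<close>.\<close>
      have e2: "x * (?G m * ?N) $ k = (\<Sum>s\<in>{m..m + k}. ?K $ s * ?N $ (m + k - s))"
      proof -
        have "x * (?G m * ?N) $ k = (\<Sum>j\<le>k. x * (?N $ (m + j) * ?N $ (k - j)))"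
          by (simp add: fps_mult_nth atLeast0AtMost sum_distrib_left)
        also have "\<dots> = (\<Sum>s\<in>{m..m + k}. ?K $ s * ?N $ (m + k - s))"
          by (rule sum.reindex_bij_witness[where i = "\<lambda>s. s - m" and j = "\<lambda>j. m + j"])
            (use 2(2) in auto)
        finally show ?thesis .
      qed
      have e3: "(?K * ?N) $ (m + k) = (\<Sum>s<m. ?K $ s * ?N $ (m + k - s)) +
          (\<Sum>s\<in>{m..m + k}. ?K $ s * ?N $ (m + k - s))"
        unfolding fps_mult_nth
        by (subst sum.union_disjoint[symmetric]) (auto intro!: sum.cong)
      have e4: "?N $ (n + k) = ?K $ (m + k) + (?K * ?N) $ (m + k)"
        using N_Suc[of "m + k"] 2(1) by (simp add: algebra_simps)
      have e5: "?K $ (m + k) = x * ?N $ (m + k)" using 2(2) by simp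
      have "(fps_const x * (?G m * (1 + ?N)) + (\<Sum>i\<in>{1..m}. fps_const (?K $ (m - i)) * ?G i)) $ k =
          x * ?N $ (m + k) + x * (?G m * ?N) $ k + (\<Sum>i\<in>{1..m}. ?K $ (m - i) * ?N $ (i + k))"
        by (simp only: fps_add_nth fps_mult_left_const_nth fps_sum_nth fps_nth_Abs_fps distrib_left
            mult_1_right)
      also have "\<dots> = ?G n $ k"
        unfolding e1 e2 fps_nth_Abs_fps e4 e3 e5 by (simp only: ac_simps)
      finally show "(fps_const x * (?G m * (1 + ?N)) +
          (\<Sum>i\<in>{1..m}. fps_const (?K $ (m - i)) * ?G i)) $ k = ?G n $ k" .
    qed
    finally show ?thesis .
  qed
qed

section \<open>Cycle statistics and the final identity\<close>

lemma poly_B_perm: "poly (B_perm k w) x = (\<Prod>c\<in>orbit w ` {1..k}. poly (narayana_B_poly (card c)) x)"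
  by (simp add: B_perm_def cycle_type_def cycle_supports_def poly_prod_mset
      image_mset.compositionality o_def prod_unfold_prod_mset)

lemma num_cycles_conv_card: "num_cycles k w = card (orbit w ` {1..k})"
  by (simp add: num_cycles_def cycle_type_def cycle_supports_def)

theorem corollary5p2:
  fixes n k :: nat
  assumes "n \<ge> 1" and "k \<ge> 1"
  shows "narayana_poly (n + k) =
    smult (1 / fact k)
      (\<Sum>w\<in>sym_perms k. B_perm k w * narayana2_poly n (num_cycles k w))"
proof -
  \<comment> \<open>Rational polynomials are determined by their values at all rational
    \<open>x\<close>, so the series identities for fixed \<open>x\<close> suffice.\<close>
  have "poly (narayana_poly (n + k)) x = poly (smult (1 / fact k)
      (\<Sum>w\<in>sym_perms k. B_perm k w * narayana2_poly n (num_cycles k w))) x" for x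
  proof -
    have "poly (\<Sum>w\<in>sym_perms k. B_perm k w * narayana2_poly n (num_cycles k w)) x =
        fact k * (narayana2_egf x n oo cycle_series x) $ k"
      using exponential_formula_cycles[of "{1..k}" "\<lambda>m. poly (narayana_B_poly m) x"
          "\<lambda>l. poly (narayana2_poly n l) x"]
      by (simp add: poly_sum poly_B_perm num_cycles_conv_card sym_perms_def narayana2_egf_def
          cycle_series_def)
    also have "\<dots> = fact k * poly (narayana_poly (n + k)) x"
      using assms by (simp add: narayana2_egf_compose narayana_ogf_nth)
    finally show ?thesis by simp
  qed
  then show ?thesis by (simp add: poly_eq_poly_eq_iff[symmetric] fun_eq_iff)
qed

end
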